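(* Let $R$ be a commutative ring with a maximal ideal $\mathfrak{m}\subset R$ such that the localisation $R_{\mathfrak{m}}$ is a regular local ring of dimension $m\ge 3$. Suppose further that $n\ge 2$ is an integer such that $n\le \frac{m^2+2m+5}{8}$. Then there exists a matrix in $\mathrm{M}_n(R)$ of trace $0$ that is not a commutator.
   Context: $\mathrm{M}_n(R)$ is the ring of $n\times n$ matrices over $R$. A matrix $C\in \mathrm{M}_n(R)$ is a commutator if there exist $A,B\in \mathrm{M}_n(R)$ with $C=[A,B]:=AB-BA$. A regular local ring is in particular Noetherian; $R$ itself is not assumed to be Noetherian. *)

theory Defs
  imports
    "HOL-Algebra.Algebra"
    "HOL-Library.Extended_Nat"
    "Jordan_Normal_Form.Matrix"
begin

section \<open>Matrices over a ring with explicit carrier\<close>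

text \<open>The ring \<open>M\<^sub>n(R)\<close>.  The type of its elements is the matrix type of \<open>Jordan_Normal_Form\<close>, but the
  operations come from the record \<open>R\<close>, not from the type class instances on matrix entries.
  \<^const>\<open>mat\<close> makes matrices extensional, so matrix equality is equality of all entries with
  indices below \<open>n\<close>.\<close>

definition matrix_ring :: "('a, 'b) ring_scheme \<Rightarrow> nat \<Rightarrow> 'a mat ring" where
  "matrix_ring R n =
    \<lparr>carrier = {A \<in> carrier_mat n n. \<forall>i<n. \<forall>j<n. A $$ (i, j) \<in> carrier R},
     monoid.mult = (\<lambda>A B. mat n n (\<lambda>(i, j). \<Oplus>\<^bsub>R\<^esub>k\<in>{..<n}. A $$ (i, k) \<otimes>\<^bsub>R\<^esub> B $$ (k, j))),
     one = mat n n (\<lambda>(i, j). if i = j then \<one>\<^bsub>R\<^esub> else \<zero>\<^bsub>R\<^esub>),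
     ring.zero = mat n n (\<lambda>_. \<zero>\<^bsub>R\<^esub>),
     add = (\<lambda>A B. mat n n (\<lambda>(i, j). A $$ (i, j) \<oplus>\<^bsub>R\<^esub> B $$ (i, j)))\<rparr>"

definition matrix_trace :: "('a, 'b) ring_scheme \<Rightarrow> nat \<Rightarrow> 'a mat \<Rightarrow> 'a" where
  "matrix_trace R n A = (\<Oplus>\<^bsub>R\<^esub>i\<in>{..<n}. A $$ (i, i))"

definition is_commutator :: "('a, 'b) ring_scheme \<Rightarrow> 'a \<Rightarrow> bool" where
  "is_commutator M C \<longleftrightarrow>
    (\<exists>A\<in>carrier M. \<exists>B\<in>carrier M. C = A \<otimes>\<^bsub>M\<^esub> B \<ominus>\<^bsub>M\<^esub> B \<otimes>\<^bsub>M\<^esub> A)"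

lemma (in ring) finsum_finsum_swap:
  assumes "finite A" "finite B" "\<And>i j. i \<in> A \<Longrightarrow> j \<in> B \<Longrightarrow> f i j \<in> carrier R"
  shows "(\<Oplus>i\<in>A. \<Oplus>j\<in>B. f i j) = (\<Oplus>j\<in>B. \<Oplus>i\<in>A. f i j)"
  using assms(1,3)
proof (induction A rule: finite_induct)
  case empty
  then show ?case by simp
next
  case (insert x A)
  have "(\<Oplus>i\<in>insert x A. \<Oplus>j\<in>B. f i j) = (\<Oplus>j\<in>B. f x j) \<oplus> (\<Oplus>j\<in>B. \<Oplus>i\<in>A. f i j)"
    using insert by (simp add: Pi_def)
  also have "\<dots> = (\<Oplus>j\<in>B. f x j \<oplus> (\<Oplus>i\<in>A. f i j))"
    by (rule finsum_addf[symmetric]) (auto simp: insert intro!: finsum_closed)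
  also have "\<dots> = (\<Oplus>j\<in>B. \<Oplus>i\<in>insert x A. f i j)"
    by (rule finsum_cong') (auto simp: insert Pi_def intro!: finsum_closed)
  finally show ?case .
qed

lemma (in ring) finsum_delta_left:
  assumes "i < (n::nat)" "\<And>k. k < n \<Longrightarrow> f k \<in> carrier R"
  shows "(\<Oplus>k\<in>{..<n}. (if i = k then \<one> else \<zero>) \<otimes> f k) = f i"
proof -
  have "(\<Oplus>k\<in>{..<n}. (if i = k then \<one> else \<zero>) \<otimes> f k) = (\<Oplus>k\<in>{..<n}. if i = k then f k else \<zero>)"
    by (rule finsum_cong') (use assms in auto)
  also have "\<dots> = f i" using assms by (intro add.finprod_singleton) auto
  finally show ?thesis .
qed

lemma (in ring) finsum_delta_right:
  assumes "j < (n::nat)" "\<And>k. k < n \<Longrightarrow> f k \<in> carrier R"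
  shows "(\<Oplus>k\<in>{..<n}. f k \<otimes> (if k = j then \<one> else \<zero>)) = f j"
proof -
  have "(\<Oplus>k\<in>{..<n}. f k \<otimes> (if k = j then \<one> else \<zero>)) = (\<Oplus>k\<in>{..<n}. if j = k then f k else \<zero>)"
    by (rule finsum_cong') (use assms in auto)
  also have "\<dots> = f j" using assms by (intro add.finprod_singleton) auto
  finally show ?thesis .
qed

lemma (in ring) ring_matrix_ring: "ring (matrix_ring R n)"
proof (rule ringI)
  show "abelian_group (matrix_ring R n)"
  proof (rule abelian_groupI)
    fix A assume A: "A \<in> carrier (matrix_ring R n)"
    show "\<exists>B\<in>carrier (matrix_ring R n). B \<oplus>\<^bsub>matrix_ring R n\<^esub> A = \<zero>\<^bsub>matrix_ring R n\<^esub>"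
      using A by (intro bexI[of _ "mat n n (\<lambda>(i, j). \<ominus> (A $$ (i, j)))"])
        (auto simp: matrix_ring_def l_neg)
  qed (auto simp: matrix_ring_def a_ac)
next
  show "monoid (matrix_ring R n)"
  proof (rule monoidI)
    fix A B C
    assume A: "A \<in> carrier (matrix_ring R n)" and B: "B \<in> carrier (matrix_ring R n)"
      and C: "C \<in> carrier (matrix_ring R n)"
    have "(\<Oplus>k\<in>{..<n}. (\<Oplus>l\<in>{..<n}. A $$ (i, l) \<otimes> B $$ (l, k)) \<otimes> C $$ (k, j)) =
      (\<Oplus>l\<in>{..<n}. A $$ (i, l) \<otimes> (\<Oplus>k\<in>{..<n}. B $$ (l, k) \<otimes> C $$ (k, j)))"
      if ij: "i < n" "j < n" for i j
    proof -
      have "(\<Oplus>k\<in>{..<n}. (\<Oplus>l\<in>{..<n}. A $$ (i, l) \<otimes> B $$ (l, k)) \<otimes> C $$ (k, j))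
        = (\<Oplus>k\<in>{..<n}. \<Oplus>l\<in>{..<n}. A $$ (i, l) \<otimes> B $$ (l, k) \<otimes> C $$ (k, j))"
        by (intro finsum_cong' refl finsum_ldistr)
          (use A B C ij in \<open>auto simp: matrix_ring_def intro!: finsum_closed\<close>)
      also have "\<dots> = (\<Oplus>l\<in>{..<n}. \<Oplus>k\<in>{..<n}. A $$ (i, l) \<otimes> B $$ (l, k) \<otimes> C $$ (k, j))"
        by (rule finsum_finsum_swap) (use A B C ij in \<open>auto simp: matrix_ring_def\<close>)
      also have "\<dots> = (\<Oplus>l\<in>{..<n}. \<Oplus>k\<in>{..<n}. A $$ (i, l) \<otimes> (B $$ (l, k) \<otimes> C $$ (k, j)))"
        by (intro finsum_cong' refl)
          (use A B C ij in \<open>auto simp: matrix_ring_def m_assoc intro!: finsum_closed\<close>)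
      also have "\<dots> = (\<Oplus>l\<in>{..<n}. A $$ (i, l) \<otimes> (\<Oplus>k\<in>{..<n}. B $$ (l, k) \<otimes> C $$ (k, j)))"
        by (intro finsum_cong' refl finsum_rdistr[symmetric])
          (use A B C ij in \<open>auto simp: matrix_ring_def intro!: finsum_closed\<close>)
      finally show ?thesis .
    qed
    then show "A \<otimes>\<^bsub>matrix_ring R n\<^esub> B \<otimes>\<^bsub>matrix_ring R n\<^esub> C =
        A \<otimes>\<^bsub>matrix_ring R n\<^esub> (B \<otimes>\<^bsub>matrix_ring R n\<^esub> C)"
      using A B C by (intro eq_matI) (auto simp: matrix_ring_def cong: finsum_cong)
  next
    fix A assume A: "A \<in> carrier (matrix_ring R n)"
    show "\<one>\<^bsub>matrix_ring R n\<^esub> \<otimes>\<^bsub>matrix_ring R n\<^esub> A = A"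
    proof (rule eq_matI)
      fix i j assume ij: "i < dim_row A" "j < dim_col A"
      then have ij: "i < n" "j < n" using A by (auto simp: matrix_ring_def)
      have "(\<one>\<^bsub>matrix_ring R n\<^esub> \<otimes>\<^bsub>matrix_ring R n\<^esub> A) $$ (i, j) =
        (\<Oplus>k\<in>{..<n}. (if i = k then \<one> else \<zero>) \<otimes> A $$ (k, j))"
        using ij A by (auto simp: matrix_ring_def intro!: finsum_cong')
      also have "\<dots> = A $$ (i, j)"
        by (rule finsum_delta_left) (use ij A in \<open>auto simp: matrix_ring_def\<close>)
      finally show "(\<one>\<^bsub>matrix_ring R n\<^esub> \<otimes>\<^bsub>matrix_ring R n\<^esub> A) $$ (i, j) = A $$ (i, j)" .
    qed (use A in \<open>auto simp: matrix_ring_def\<close>)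
    show "A \<otimes>\<^bsub>matrix_ring R n\<^esub> \<one>\<^bsub>matrix_ring R n\<^esub> = A"
    proof (rule eq_matI)
      fix i j assume ij: "i < dim_row A" "j < dim_col A"
      then have ij: "i < n" "j < n" using A by (auto simp: matrix_ring_def)
      have "(A \<otimes>\<^bsub>matrix_ring R n\<^esub> \<one>\<^bsub>matrix_ring R n\<^esub>) $$ (i, j) =
        (\<Oplus>k\<in>{..<n}. A $$ (i, k) \<otimes> (if k = j then \<one> else \<zero>))"
        using ij A by (auto simp: matrix_ring_def intro!: finsum_cong')
      also have "\<dots> = A $$ (i, j)"
        by (rule finsum_delta_right) (use ij A in \<open>auto simp: matrix_ring_def\<close>)
      finally show "(A \<otimes>\<^bsub>matrix_ring R n\<^esub> \<one>\<^bsub>matrix_ring R n\<^esub>) $$ (i, j) = A $$ (i, j)" .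
    qed (use A in \<open>auto simp: matrix_ring_def\<close>)
  qed (auto simp: matrix_ring_def intro!: finsum_closed)
next
  fix A B C
  assume A: "A \<in> carrier (matrix_ring R n)" and B: "B \<in> carrier (matrix_ring R n)"
    and C: "C \<in> carrier (matrix_ring R n)"
  have "(\<Oplus>k\<in>{..<n}. (A $$ (i, k) \<oplus> B $$ (i, k)) \<otimes> C $$ (k, j)) =
      (\<Oplus>k\<in>{..<n}. A $$ (i, k) \<otimes> C $$ (k, j)) \<oplus> (\<Oplus>k\<in>{..<n}. B $$ (i, k) \<otimes> C $$ (k, j))"
    if ij: "i < n" "j < n" for i j
    by (subst finsum_addf[symmetric], use A B C ij in \<open>force simp: matrix_ring_def\<close>,
        use A B C ij in \<open>force simp: matrix_ring_def\<close>, intro finsum_cong')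
      (use A B C ij in \<open>auto simp: matrix_ring_def l_distr\<close>)
  then show "(A \<oplus>\<^bsub>matrix_ring R n\<^esub> B) \<otimes>\<^bsub>matrix_ring R n\<^esub> C =
      A \<otimes>\<^bsub>matrix_ring R n\<^esub> C \<oplus>\<^bsub>matrix_ring R n\<^esub> B \<otimes>\<^bsub>matrix_ring R n\<^esub> C"
    using A B C by (intro eq_matI) (auto simp: matrix_ring_def cong: finsum_cong)
  have "(\<Oplus>k\<in>{..<n}. C $$ (i, k) \<otimes> (A $$ (k, j) \<oplus> B $$ (k, j))) =
      (\<Oplus>k\<in>{..<n}. C $$ (i, k) \<otimes> A $$ (k, j)) \<oplus> (\<Oplus>k\<in>{..<n}. C $$ (i, k) \<otimes> B $$ (k, j))"
    if ij: "i < n" "j < n" for i j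
    by (subst finsum_addf[symmetric], use A B C ij in \<open>force simp: matrix_ring_def\<close>,
        use A B C ij in \<open>force simp: matrix_ring_def\<close>, intro finsum_cong')
      (use A B C ij in \<open>auto simp: matrix_ring_def r_distr\<close>)
  then show "C \<otimes>\<^bsub>matrix_ring R n\<^esub> (A \<oplus>\<^bsub>matrix_ring R n\<^esub> B) =
      C \<otimes>\<^bsub>matrix_ring R n\<^esub> A \<oplus>\<^bsub>matrix_ring R n\<^esub> C \<otimes>\<^bsub>matrix_ring R n\<^esub> B"
    using A B C by (intro eq_matI) (auto simp: matrix_ring_def cong: finsum_cong)
qed


section \<open>Localisation of a commutative ring\<close>

definition frac_rel :: "('a, 'b) ring_scheme \<Rightarrow> 'a set \<Rightarrow> (('a \<times> 'a) \<times> ('a \<times> 'a)) set" where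
  "frac_rel R S = {((a, s), (b, t)). a \<in> carrier R \<and> b \<in> carrier R \<and> s \<in> S \<and> t \<in> S \<and>
     (\<exists>u\<in>S. u \<otimes>\<^bsub>R\<^esub> (a \<otimes>\<^bsub>R\<^esub> t) = u \<otimes>\<^bsub>R\<^esub> (b \<otimes>\<^bsub>R\<^esub> s))}"

text \<open>The fraction \<open>a/s\<close>.\<close>

definition frac_class :: "('a, 'b) ring_scheme \<Rightarrow> 'a set \<Rightarrow> 'a \<Rightarrow> 'a \<Rightarrow> ('a \<times> 'a) set" where
  "frac_class R S a s = frac_rel R S `` {(a, s)}"

text \<open>The ring \<open>S\<^sup>-\<^sup>1R\<close> for a multiplicative subset \<open>S\<close>.  Sums and products of classes are written as
  unions over all representatives; each such union is a single class (see \<open>mult_frac\<close>,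
  \<open>add_frac\<close>).\<close>

definition localization :: "('a, 'b) ring_scheme \<Rightarrow> 'a set \<Rightarrow> ('a \<times> 'a) set ring" where
  "localization R S =
    \<lparr>carrier = (carrier R \<times> S) // frac_rel R S,
     monoid.mult = (\<lambda>F G. \<Union>(a, s)\<in>F. \<Union>(b, t)\<in>G. frac_class R S (a \<otimes>\<^bsub>R\<^esub> b) (s \<otimes>\<^bsub>R\<^esub> t)),
     one = frac_class R S \<one>\<^bsub>R\<^esub> \<one>\<^bsub>R\<^esub>,
     ring.zero = frac_class R S \<zero>\<^bsub>R\<^esub> \<one>\<^bsub>R\<^esub>,
     add = (\<lambda>F G. \<Union>(a, s)\<in>F. \<Union>(b, t)\<in>G.
        frac_class R S (a \<otimes>\<^bsub>R\<^esub> t \<oplus>\<^bsub>R\<^esub> b \<otimes>\<^bsub>R\<^esub> s) (s \<otimes>\<^bsub>R\<^esub> t))\<rparr>"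

definition localization_at :: "('a, 'b) ring_scheme \<Rightarrow> 'a set \<Rightarrow> ('a \<times> 'a) set ring" where
  "localization_at R P = localization R (carrier R - P)"

locale mult_subset = cring R + submonoid S R for R (structure) and S
begin

lemma S_carrier: "s \<in> S \<Longrightarrow> s \<in> carrier R"
  using subset by auto

lemma equiv_frac_rel: "equiv (carrier R \<times> S) (frac_rel R S)"
proof (rule equivI)
  show "frac_rel R S \<subseteq> (carrier R \<times> S) \<times> (carrier R \<times> S)"
    by (auto simp: frac_rel_def)
  show "refl_on (carrier R \<times> S) (frac_rel R S)"
    by (auto simp: frac_rel_def refl_on_def)
  show "sym (frac_rel R S)"
    by (auto simp: frac_rel_def sym_def) metis
  show "trans (frac_rel R S)"
  proof (rule transI, clarify)
    fix a s b t c r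
    assume "((a, s), (b, t)) \<in> frac_rel R S" "((b, t), (c, r)) \<in> frac_rel R S"
    then obtain u v where *: "a \<in> carrier R" "b \<in> carrier R" "c \<in> carrier R" "s \<in> S" "t \<in> S" "r \<in> S"
      "u \<in> S" "v \<in> S" and u: "u \<otimes> (a \<otimes> t) = u \<otimes> (b \<otimes> s)" and v: "v \<otimes> (b \<otimes> r) = v \<otimes> (c \<otimes> t)"
      by (auto simp: frac_rel_def)
    note ** = * *(4-8)[THEN S_carrier]
    have "(u \<otimes> v \<otimes> t) \<otimes> (a \<otimes> r) = (v \<otimes> r) \<otimes> (u \<otimes> (a \<otimes> t))"
      using ** by (simp add: m_ac)
    also have "\<dots> = (u \<otimes> s) \<otimes> (v \<otimes> (b \<otimes> r))" unfolding u using ** by (simp add: m_ac)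
    also have "\<dots> = (u \<otimes> v \<otimes> t) \<otimes> (c \<otimes> s)" unfolding v using ** by (simp add: m_ac)
    finally show "((a, s), (c, r)) \<in> frac_rel R S"
      using ** by (auto simp: frac_rel_def intro!: bexI[of _ "u \<otimes> v \<otimes> t"])
  qed
qed

lemma frac_class_eq_iff:
  assumes "a \<in> carrier R" "b \<in> carrier R" "s \<in> S" "t \<in> S"
  shows "frac_class R S a s = frac_class R S b t \<longleftrightarrow> (\<exists>u\<in>S. u \<otimes> (a \<otimes> t) = u \<otimes> (b \<otimes> s))"
  unfolding frac_class_def using eq_equiv_class_iff[OF equiv_frac_rel, of "(a, s)" "(b, t)"] assms
  by (auto simp: frac_rel_def)

lemma frac_class_carrier [simp]:
  "a \<in> carrier R \<Longrightarrow> s \<in> S \<Longrightarrow> frac_class R S a s \<in> carrier (localization R S)"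
  by (auto simp: localization_def frac_class_def intro: quotientI)

lemma frac_cases:
  assumes "F \<in> carrier (localization R S)"
  obtains a s where "a \<in> carrier R" "s \<in> S" "F = frac_class R S a s"
  using assms by (auto simp: localization_def frac_class_def elim!: quotientE)

lemma mult_frac:
  assumes "a \<in> carrier R" "b \<in> carrier R" "s \<in> S" "t \<in> S"
  shows "frac_class R S a s \<otimes>\<^bsub>localization R S\<^esub> frac_class R S b t = frac_class R S (a \<otimes> b) (s \<otimes> t)"
proof -
  have "congruent2 (frac_rel R S) (frac_rel R S) (\<lambda>(a, s) (b, t). frac_class R S (a \<otimes> b) (s \<otimes> t))"
  proof (rule congruent2I', clarify)
    fix a s a' s' b t b' t'
    assume "((a, s), (a', s')) \<in> frac_rel R S" "((b, t), (b', t')) \<in> frac_rel R S"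
    then obtain u v where *: "a \<in> carrier R" "a' \<in> carrier R" "b \<in> carrier R" "b' \<in> carrier R"
      "s \<in> S" "s' \<in> S" "t \<in> S" "t' \<in> S" "u \<in> S" "v \<in> S"
      and u: "u \<otimes> (a \<otimes> s') = u \<otimes> (a' \<otimes> s)" and v: "v \<otimes> (b \<otimes> t') = v \<otimes> (b' \<otimes> t)"
      by (auto simp: frac_rel_def)
    note ** = * *(5-10)[THEN S_carrier]
    have "(u \<otimes> v) \<otimes> (a \<otimes> b \<otimes> (s' \<otimes> t')) = (u \<otimes> (a \<otimes> s')) \<otimes> (v \<otimes> (b \<otimes> t'))"
      using ** by (simp add: m_ac)
    also have "\<dots> = (u \<otimes> v) \<otimes> (a' \<otimes> b' \<otimes> (s \<otimes> t))" unfolding u v using ** by (simp add: m_ac)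
    finally show "frac_class R S (a \<otimes> b) (s \<otimes> t) = frac_class R S (a' \<otimes> b') (s' \<otimes> t')"
      using ** by (subst frac_class_eq_iff) (auto intro!: bexI[of _ "u \<otimes> v"])
  qed
  from UN_equiv_class2[OF equiv_frac_rel equiv_frac_rel this, of "(a, s)" "(b, t)"] show ?thesis
    using assms by (simp add: localization_def frac_class_def case_prod_unfold)
qed

lemma add_frac:
  assumes "a \<in> carrier R" "b \<in> carrier R" "s \<in> S" "t \<in> S"
  shows "frac_class R S a s \<oplus>\<^bsub>localization R S\<^esub> frac_class R S b t =
    frac_class R S (a \<otimes> t \<oplus> b \<otimes> s) (s \<otimes> t)"
proof -
  have "congruent2 (frac_rel R S) (frac_rel R S)
    (\<lambda>(a, s) (b, t). frac_class R S (a \<otimes> t \<oplus> b \<otimes> s) (s \<otimes> t))"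
  proof (rule congruent2I', clarify)
    fix a s a' s' b t b' t'
    assume "((a, s), (a', s')) \<in> frac_rel R S" "((b, t), (b', t')) \<in> frac_rel R S"
    then obtain u v where *: "a \<in> carrier R" "a' \<in> carrier R" "b \<in> carrier R" "b' \<in> carrier R"
      "s \<in> S" "s' \<in> S" "t \<in> S" "t' \<in> S" "u \<in> S" "v \<in> S"
      and u: "u \<otimes> (a \<otimes> s') = u \<otimes> (a' \<otimes> s)" and v: "v \<otimes> (b \<otimes> t') = v \<otimes> (b' \<otimes> t)"
      by (auto simp: frac_rel_def)
    note ** = * *(5-10)[THEN S_carrier]
    have "(u \<otimes> v) \<otimes> ((a \<otimes> t \<oplus> b \<otimes> s) \<otimes> (s' \<otimes> t')) =
      (v \<otimes> t \<otimes> t') \<otimes> (u \<otimes> (a \<otimes> s')) \<oplus> (u \<otimes> s \<otimes> s') \<otimes> (v \<otimes> (b \<otimes> t'))"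
      using ** by (simp add: m_ac r_distr l_distr)
    also have "\<dots> = (u \<otimes> v) \<otimes> ((a' \<otimes> t' \<oplus> b' \<otimes> s') \<otimes> (s \<otimes> t))"
      unfolding u v using ** by (simp add: m_ac r_distr l_distr)
    finally show "frac_class R S (a \<otimes> t \<oplus> b \<otimes> s) (s \<otimes> t) =
        frac_class R S (a' \<otimes> t' \<oplus> b' \<otimes> s') (s' \<otimes> t')"
      using ** by (subst frac_class_eq_iff) (auto intro!: bexI[of _ "u \<otimes> v"])
  qed
  from UN_equiv_class2[OF equiv_frac_rel equiv_frac_rel this, of "(a, s)" "(b, t)"] show ?thesis
    using assms by (simp add: localization_def frac_class_def case_prod_unfold)
qed

lemma zero_frac: "\<zero>\<^bsub>localization R S\<^esub> = frac_class R S \<zero> \<one>"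
  and one_frac: "\<one>\<^bsub>localization R S\<^esub> = frac_class R S \<one> \<one>"
  by (simp_all add: localization_def)

lemma frac_class_eqI:
  assumes "a \<in> carrier R" "b \<in> carrier R" "s \<in> S" "t \<in> S" "a \<otimes> t = b \<otimes> s"
  shows "frac_class R S a s = frac_class R S b t"
  using assms by (subst frac_class_eq_iff) (auto intro!: bexI[of _ \<one>])

lemma cring_localization: "cring (localization R S)" (is "cring ?L")
proof (rule cringI)
  show "abelian_group ?L"
  proof (rule abelian_groupI)
    fix F assume "F \<in> carrier ?L"
    then obtain a s where F: "a \<in> carrier R" "s \<in> S" "F = frac_class R S a s" by (rule frac_cases)
    have "\<ominus> a \<otimes> s \<oplus> a \<otimes> s = \<zero>"
      using F S_carrier by (simp add: l_distr[symmetric] l_neg)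
    then have "frac_class R S (\<ominus> a) s \<oplus>\<^bsub>?L\<^esub> F = \<zero>\<^bsub>?L\<^esub>"
      using F S_carrier by (simp add: add_frac zero_frac) (rule frac_class_eqI, simp_all)
    then show "\<exists>G\<in>carrier ?L. G \<oplus>\<^bsub>?L\<^esub> F = \<zero>\<^bsub>?L\<^esub>"
      using F by (intro bexI[of _ "frac_class R S (\<ominus> a) s"]) simp_all
    show "\<zero>\<^bsub>?L\<^esub> \<oplus>\<^bsub>?L\<^esub> F = F"
      using F S_carrier by (simp add: add_frac zero_frac)
  next
    fix F G H assume "F \<in> carrier ?L" "G \<in> carrier ?L" "H \<in> carrier ?L"
    then show "F \<oplus>\<^bsub>?L\<^esub> G \<oplus>\<^bsub>?L\<^esub> H = F \<oplus>\<^bsub>?L\<^esub> (G \<oplus>\<^bsub>?L\<^esub> H)"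
      by (elim frac_cases) (simp add: add_frac S_carrier l_distr r_distr m_ac a_ac)
  next
    fix F G assume "F \<in> carrier ?L" "G \<in> carrier ?L"
    then show "F \<oplus>\<^bsub>?L\<^esub> G \<in> carrier ?L" "F \<oplus>\<^bsub>?L\<^esub> G = G \<oplus>\<^bsub>?L\<^esub> F"
      by (elim frac_cases; simp add: add_frac S_carrier m_comm a_comm)+
  qed (simp add: zero_frac)
  show "comm_monoid ?L"
  proof (rule comm_monoidI)
    fix F G H assume "F \<in> carrier ?L" "G \<in> carrier ?L" "H \<in> carrier ?L"
    then show "F \<otimes>\<^bsub>?L\<^esub> G \<otimes>\<^bsub>?L\<^esub> H = F \<otimes>\<^bsub>?L\<^esub> (G \<otimes>\<^bsub>?L\<^esub> H)"
      by (elim frac_cases) (simp add: mult_frac S_carrier m_ac)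
  next
    fix F G assume "F \<in> carrier ?L" "G \<in> carrier ?L"
    then show "F \<otimes>\<^bsub>?L\<^esub> G \<in> carrier ?L" "F \<otimes>\<^bsub>?L\<^esub> G = G \<otimes>\<^bsub>?L\<^esub> F"
      by (elim frac_cases; simp add: mult_frac S_carrier m_comm)+
  next
    fix F assume "F \<in> carrier ?L"
    then show "\<one>\<^bsub>?L\<^esub> \<otimes>\<^bsub>?L\<^esub> F = F"
      by (elim frac_cases) (simp add: mult_frac one_frac S_carrier)
  qed (simp add: one_frac)
  fix F G H assume "F \<in> carrier ?L" "G \<in> carrier ?L" "H \<in> carrier ?L"
  then obtain a s b t c r where *: "a \<in> carrier R" "s \<in> S" "F = frac_class R S a s"
    "b \<in> carrier R" "t \<in> S" "G = frac_class R S b t" "c \<in> carrier R" "r \<in> S" "H = frac_class R S c r"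
    by (elim frac_cases)
  have "(a \<otimes> t \<oplus> b \<otimes> s) \<otimes> c \<otimes> (s \<otimes> r \<otimes> (t \<otimes> r)) =
      (a \<otimes> c \<otimes> (t \<otimes> r) \<oplus> b \<otimes> c \<otimes> (s \<otimes> r)) \<otimes> (s \<otimes> t \<otimes> r)"
    using * S_carrier by (simp add: l_distr r_distr m_ac)
  with * S_carrier show "(F \<oplus>\<^bsub>?L\<^esub> G) \<otimes>\<^bsub>?L\<^esub> H = F \<otimes>\<^bsub>?L\<^esub> H \<oplus>\<^bsub>?L\<^esub> G \<otimes>\<^bsub>?L\<^esub> H"
    by (simp add: mult_frac add_frac) (rule frac_class_eqI, simp_all)
qed

end

lemma (in primeideal) cring_localization_at: "cring (localization_at R I)"
proof -
  have "submonoid (carrier R - I) R"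
    using I_notcarr I_prime one_imp_carrier by unfold_locales auto
  then interpret mult_subset R "carrier R - I"
    by (intro mult_subset.intro) (rule is_cring)
  show ?thesis unfolding localization_at_def by (rule cring_localization)
qed


section \<open>Krull dimension and regular local rings\<close>

text \<open>Supremum of the lengths \<open>k\<close> of strict chains \<open>P\<^sub>0 \<subset> \<dots> \<subset> P\<^sub>k\<close> of prime ideals.
  By the convention \<open>Sup {} = 0\<close>, the zero ring gets dimension \<open>0\<close>.\<close>

definition krull_dim :: "('a, 'b) ring_scheme \<Rightarrow> enat" where
  "krull_dim R = Sup {enat k | k.
     \<exists>P :: nat \<Rightarrow> 'a set. (\<forall>i\<le>k. primeideal (P i) R) \<and> (\<forall>i<k. P i \<subset> P (Suc i))}"

locale local_ring = cring +
  assumes ex1_maximalideal: "\<exists>!M. maximalideal M R"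

definition max_ideal_of :: "('a, 'b) ring_scheme \<Rightarrow> 'a set" where
  "max_ideal_of R = (THE M. maximalideal M R)"

text \<open>Meaningful only for finitely generated ideals.\<close>

definition min_generators :: "('a, 'b) ring_scheme \<Rightarrow> 'a set \<Rightarrow> nat" where
  "min_generators R I = (LEAST d. \<exists>S. S \<subseteq> carrier R \<and> finite S \<and> card S = d \<and> Idl\<^bsub>R\<^esub> S = I)"

locale regular_local_ring = local_ring + noetherian_ring +
  assumes regular: "krull_dim R = enat (min_generators R (max_ideal_of R))"

end

(*
  A commutator C = AB - BA satisfies tr (AC) = tr (BC) = 0.  If all entries of C but the last one
  minimally generate their ideal, these relations force A and B to be scalar modulo the maximal
  ideal, so the entries of C lie in its square.  Hence it suffices to find n^2 - 1 minimal
  generators, one of which is not in the square of the maximal ideal.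

  Any local Noetherian ring of dimension at least 3 has such generators, for every n.  Take an
  element x outside the square.  By Krull's principal ideal theorem there are primes P0 < P < M
  with x in P0.  Take z in M - P, and a strictly decreasing chain of P-saturated ideals Q_k between
  P0 and P.  By Nakayama there is y_k in Q_k outside Q_(k+1) + (z), and then
  x, y_0 z^N, y_1 z^(N-1), ..., y_N are minimal generators.
*)

theory Submission
  imports Defs
begin

section \<open>Ideals saturated at a prime\<close>

text \<open>Two demands pull apart: arbitrarily many independent elements, and one of them outside
  the square of M. The products of the y_k and powers of z meet the first, but may all lie deep
  inside M, so x is added. Every Q_k contains P0, hence x, so the x term of a relation vanishes
  modulo the ideal where the independence of the products is proved. This is why the primes are
  chosen after x, and why three steps are used: one is spent on x, two remain for P0 < P < M. The
  products then have coefficients in M, their part of the relation lies in the square of M, and the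
  coefficient of x must lie in M too.

  The last diagonal entry of C is fixed by the trace and is no generator. Subtracting scalar
  matrices from A and B keeps C and removes that entry from both trace relations.

  The generators are found in the localisation, which is Noetherian, while A and B have entries in
  R; clearing denominators brings the generators back. The prime in the role of M is the top of a
  chain of three steps and may fail to be maximal in the localisation, so every statement is
  relative to a prime.\<close>

text \<open>The \<open>P\<close>-saturated ideals are the contractions of ideals of the localisation at \<open>P\<close>. Working with
  them, Krull's theorem can be proved without leaving the ring.\<close>

definition saturation :: "('a, 'b) ring_scheme \<Rightarrow> 'a set \<Rightarrow> 'a set \<Rightarrow> 'a set" where
  "saturation R P I = {a \<in> carrier R. \<exists>s\<in>carrier R - P. s \<otimes>\<^bsub>R\<^esub> a \<in> I}"

definition saturated_ideal :: "('a, 'b) ring_scheme \<Rightarrow> 'a set \<Rightarrow> 'a set \<Rightarrow> bool" where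
  "saturated_ideal R P I \<longleftrightarrow> ideal I R \<and>
    (\<forall>a\<in>carrier R. \<forall>s\<in>carrier R - P. s \<otimes>\<^bsub>R\<^esub> a \<in> I \<longrightarrow> a \<in> I)"

lemma saturated_idealD:
  assumes "saturated_ideal R P I"
  shows "ideal I R" and "\<lbrakk>a \<in> carrier R; s \<in> carrier R; s \<notin> P; s \<otimes>\<^bsub>R\<^esub> a \<in> I\<rbrakk> \<Longrightarrow> a \<in> I"
  using assms by (auto simp: saturated_ideal_def)

section \<open>Closure properties of ideals\<close>

lemma (in ring) ideal_minus_closed:
  assumes "ideal I R" "a \<in> I" "b \<in> I"
  shows "a \<ominus> b \<in> I"
  using assms by (simp add: a_minus_def additive_subgroup.a_closed additive_subgroup.a_inv_closed ideal.axioms(1))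

lemma (in ring) ideal_add_closed:
  assumes "ideal I R" "a \<in> I" "b \<in> I"
  shows "a \<oplus> b \<in> I"
  using assms by (simp add: additive_subgroup.a_closed ideal.axioms(1))

lemma (in ring) ideal_add_cancel:
  assumes "ideal I R" "a \<in> carrier R" "b \<in> I" "a \<oplus> b \<in> I"
  shows "a \<in> I"
proof -
  have "b \<in> carrier R" using assms by (simp add: ideal.Icarr)
  then have "a \<oplus> b \<ominus> b = a" using assms(2) by (simp add: a_minus_def a_assoc r_neg)
  then show ?thesis using ideal_minus_closed[OF assms(1,4,3)] by simp
qed

section \<open>Adjoining one element to an ideal\<close>

definition ideal_adjoin :: "('a, 'b) ring_scheme \<Rightarrow> 'a set \<Rightarrow> 'a \<Rightarrow> 'a set" where
  "ideal_adjoin R I b = I <+>\<^bsub>R\<^esub> PIdl\<^bsub>R\<^esub> b"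

lemma (in cring) mem_ideal_adjoin_iff:
  "a \<in> ideal_adjoin R I b \<longleftrightarrow> (\<exists>i\<in>I. \<exists>r\<in>carrier R. a = i \<oplus> r \<otimes> b)"
  unfolding ideal_adjoin_def set_add_def' cgenideal_def by auto

lemma (in cring) ideal_ideal_adjoin:
  "ideal I R \<Longrightarrow> b \<in> carrier R \<Longrightarrow> ideal (ideal_adjoin R I b) R"
  by (simp add: ideal_adjoin_def add_ideals cgenideal_ideal)

lemma (in cring) ideal_adjoin_mono:
  "I \<subseteq> J \<Longrightarrow> ideal_adjoin R I b \<subseteq> ideal_adjoin R J b"
  unfolding subset_iff mem_ideal_adjoin_iff by blast

lemma (in cring) ideal_adjoin_superset:
  assumes "ideal I R" "b \<in> carrier R"
  shows "I \<subseteq> ideal_adjoin R I b" and "b \<in> ideal_adjoin R I b"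
proof -
  show "I \<subseteq> ideal_adjoin R I b"
  proof
    fix i assume "i \<in> I"
    moreover have "i = i \<oplus> \<zero> \<otimes> b" using calculation assms by (simp add: ideal.Icarr)
    ultimately show "i \<in> ideal_adjoin R I b" unfolding mem_ideal_adjoin_iff by blast
  qed
  have "\<zero> \<in> I" using assms by (simp add: additive_subgroup.zero_closed ideal.axioms(1))
  moreover have "b = \<zero> \<oplus> \<one> \<otimes> b" using assms by simp
  ultimately show "b \<in> ideal_adjoin R I b" unfolding mem_ideal_adjoin_iff by blast
qed

section \<open>The saturation operator\<close>

lemma (in cring) saturation_superset:
  assumes "primeideal P R" "ideal I R"
  shows "I \<subseteq> saturation R P I"
proof -
  interpret P: primeideal P R by fact
  have "\<one> \<notin> P" using P.I_notcarr P.one_imp_carrier by auto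
  then show ?thesis using assms by (auto simp: saturation_def ideal.Icarr intro!: bexI[of _ \<one>])
qed

lemma (in cring) saturated_ideal_saturation:
  assumes P: "primeideal P R" and I: "ideal I R"
  shows "saturated_ideal R P (saturation R P I)"
  unfolding saturated_ideal_def
proof (intro conjI ballI impI)
  interpret P: primeideal P R by fact
  interpret I: ideal I R by fact
  show "ideal (saturation R P I) R"
  proof (rule idealI[OF ring_axioms])
    show "subgroup (saturation R P I) (add_monoid R)"
    proof (rule add.subgroupI)
      show "saturation R P I \<subseteq> carrier R" by (auto simp: saturation_def)
      show "saturation R P I \<noteq> {}"
        using saturation_superset[OF P I] I.zero_closed by blast
    next
      fix a assume "a \<in> saturation R P I"
      then show "\<ominus> a \<in> saturation R P I"
        by (auto simp: saturation_def r_minus)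
    next
      fix a b assume "a \<in> saturation R P I" "b \<in> saturation R P I"
      then obtain s t where *: "a \<in> carrier R" "b \<in> carrier R" "s \<in> carrier R" "s \<notin> P"
        "t \<in> carrier R" "t \<notin> P" "s \<otimes> a \<in> I" "t \<otimes> b \<in> I"
        by (auto simp: saturation_def)
      have "(s \<otimes> t) \<otimes> (a \<oplus> b) = t \<otimes> (s \<otimes> a) \<oplus> s \<otimes> (t \<otimes> b)"
        using * by algebra
      also have "\<dots> \<in> I" using * by (simp add: I.I_l_closed)
      finally show "a \<oplus> b \<in> saturation R P I"
        using * P.I_prime[of s t] unfolding saturation_def by blast
    qed
  next
    fix a x assume "a \<in> saturation R P I" and x: "x \<in> carrier R"
    then obtain s where *: "a \<in> carrier R" "s \<in> carrier R" "s \<notin> P" "s \<otimes> a \<in> I"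
      by (auto simp: saturation_def)
    have "s \<otimes> (x \<otimes> a) = x \<otimes> (s \<otimes> a)" using * x by algebra
    then have "s \<otimes> (x \<otimes> a) \<in> I" using * x by (simp add: I.I_l_closed)
    then show "x \<otimes> a \<in> saturation R P I" "a \<otimes> x \<in> saturation R P I"
      using * x by (auto simp: saturation_def m_comm[of a x])
  qed
next
  interpret P: primeideal P R by fact
  fix a s assume *: "a \<in> carrier R" "s \<in> carrier R - P" "s \<otimes> a \<in> saturation R P I"
  then obtain t where t: "t \<in> carrier R" "t \<notin> P" "t \<otimes> (s \<otimes> a) \<in> I" by (auto simp: saturation_def)
  then have "(t \<otimes> s) \<otimes> a \<in> I" using * by (simp add: m_assoc)
  moreover have "t \<otimes> s \<in> carrier R - P" using t * P.I_prime[of t s] by auto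
  ultimately show "a \<in> saturation R P I" using * unfolding saturation_def by blast
qed

text \<open>A larger prime leaves fewer elements to cancel. This lets ideals saturated at
  \<open>P\<close> enter Nakayama's lemma at a larger prime.\<close>

lemma saturated_ideal_antimono:
  "saturated_ideal R P I \<Longrightarrow> P \<subseteq> Q \<Longrightarrow> saturated_ideal R Q I"
  unfolding saturated_ideal_def by blast

lemma (in cring) saturated_ideal_prime:
  assumes "primeideal P R" "P \<subseteq> Q"
  shows "saturated_ideal R Q P"
  using assms primeideal.I_prime[OF assms(1)]
  unfolding saturated_ideal_def by (blast intro: primeideal.axioms(1))

text \<open>A nonempty chain of ideals contains its union, so Zorn's lemma applies to any nonempty
  family. All Noetherian arguments below go through this form of the ascending chain
  condition.\<close>

lemma (in noetherian_ring) ex_maximal_ideal_in: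
  assumes "\<And>I. I \<in> F \<Longrightarrow> ideal I R" "I0 \<in> F"
  shows "\<exists>J\<in>F. \<forall>I\<in>F. J \<subseteq> I \<longrightarrow> I = J"
proof (rule subset_Zorn)
  fix C assume C: "subset.chain F C"
  show "\<exists>U\<in>F. \<forall>T\<in>C. T \<subseteq> U"
  proof (cases "C = {}")
    case True then show ?thesis using assms(2) by auto
  next
    case False
    have "subset.chain {I. ideal I R} C"
      using C assms(1) by (auto simp: pred_on.chain_def)
    from ideal_chain_is_trivial[OF False this] have "\<Union>C \<in> F"
      using C by (auto simp: pred_on.chain_def)
    then show ?thesis by blast
  qed
qed

text \<open>The ideals are the saturations of \<open>P0 + (y\<^sup>k\<^sup>+\<^sup>1)\<close> for some \<open>y\<close> in \<open>P\<close> outside \<open>P0\<close>.\<close>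

lemma (in cring) ex_descending_saturated_ideals:
  assumes P0: "primeideal P0 R" and P: "primeideal P R" and "P0 \<subset> P"
  obtains Q :: "nat \<Rightarrow> 'a set" where "\<And>k. saturated_ideal R P (Q k)" "\<And>k. P0 \<subseteq> Q k"
    "\<And>k. Q (Suc k) \<subset> Q k" "\<And>k. Q k \<subseteq> P"
proof -
  interpret P0: primeideal P0 R by fact
  interpret P: primeideal P R by fact
  obtain y where y: "y \<in> P" "y \<notin> P0" using \<open>P0 \<subset> P\<close> by auto
  have yR [simp]: "y \<in> carrier R" using y by (simp add: P.Icarr)
  have yk: "y [^] k \<notin> P0" for k :: nat
  proof (induction k)
    case 0
    then show ?case using P0.I_notcarr P0.one_imp_carrier by auto
  next
    case (Suc k)
    then show ?case using y P0.I_prime[of "y [^] k" y] by auto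
  qed
  \<comment> \<open>The exponent starts at one, so that already \<open>Q 0\<close> lies in
    \<open>P\<close>.\<close>
  define Q where "Q k = saturation R P (ideal_adjoin R P0 (y [^] Suc k))" for k
  have id: "ideal (ideal_adjoin R P0 (y [^] k)) R" for k :: nat
    by (intro ideal_ideal_adjoin P0.is_ideal) simp
  note sup = ideal_adjoin_superset[OF P0.is_ideal, of "y [^] (k::nat)" for k, simplified]
  have memQ: "a \<in> Q k \<longleftrightarrow> a \<in> carrier R \<and> (\<exists>s\<in>carrier R - P. \<exists>i\<in>P0. \<exists>r\<in>carrier R.
      s \<otimes> a = i \<oplus> r \<otimes> y [^] Suc k)" for a k
    unfolding Q_def saturation_def mem_ideal_adjoin_iff by blast
  have 1: "saturated_ideal R P (Q k)" for k
    unfolding Q_def by (intro saturated_ideal_saturation P id)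
  have 2: "P0 \<subseteq> Q k" "y [^] Suc k \<in> Q k" for k
    unfolding Q_def using saturation_superset[OF P id[of "Suc k"]] sup[of "Suc k"] by auto
  have 3: "Q (Suc k) \<subseteq> Q k" for k
  proof
    fix a assume "a \<in> Q (Suc k)"
    then obtain s i r where *: "a \<in> carrier R" "s \<in> carrier R" "s \<notin> P" "i \<in> P0" "r \<in> carrier R"
      "s \<otimes> a = i \<oplus> r \<otimes> y [^] Suc (Suc k)" unfolding memQ by blast
    have "s \<otimes> a = i \<oplus> (r \<otimes> y) \<otimes> y [^] Suc k"
      unfolding *(6) using * by (simp add: m_ac P0.Icarr)
    then show "a \<in> Q k" using * unfolding memQ by (blast intro: m_closed yR)
  qed
  \<comment> \<open>A relation would put \<open>(s \<ominus> r \<otimes> y) \<otimes> w\<close> into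
    \<open>P0\<close>, where \<open>w\<close> is a power of \<open>y\<close> and so outside
    \<open>P0\<close>. Then \<open>s \<ominus> r \<otimes> y\<close> is in \<open>P0\<close>, hence
    in \<open>P\<close>; as \<open>y\<close> is in \<open>P\<close>, so is \<open>s\<close>.\<close>
  have 4: "y [^] Suc k \<notin> Q (Suc k)" for k
  proof
    assume "y [^] Suc k \<in> Q (Suc k)"
    then obtain s i r where *: "s \<in> carrier R" "s \<notin> P" "i \<in> P0" "r \<in> carrier R"
      "s \<otimes> y [^] Suc k = i \<oplus> r \<otimes> y [^] Suc (Suc k)" unfolding memQ by blast
    define w where "w = y [^] Suc k"
    have w: "w \<in> carrier R" "s \<otimes> w = i \<oplus> r \<otimes> (w \<otimes> y)" using * by (simp_all add: w_def)
    have iR: "i \<in> carrier R" using * by (simp add: P0.Icarr)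
    have "(s \<ominus> r \<otimes> y) \<otimes> w = s \<otimes> w \<ominus> r \<otimes> (w \<otimes> y)" using *(1,4) w(1) yR by algebra
    also have "\<dots> = i" unfolding w(2) using *(1,4) w(1) iR yR by algebra
    finally have "(s \<ominus> r \<otimes> y) \<otimes> w \<in> P0" using * by simp
    then have "s \<ominus> r \<otimes> y \<in> P0" using P0.I_prime[of "s \<ominus> r \<otimes> y" w] yk[of "Suc k"] * w
      by (auto simp: w_def)
    then have "s \<ominus> r \<otimes> y \<in> P" using \<open>P0 \<subset> P\<close> by auto
    moreover have "r \<otimes> y \<in> P" using y * by (simp add: P.I_l_closed)
    moreover have "s = (s \<ominus> r \<otimes> y) \<oplus> r \<otimes> y" using *(1,4) yR by algebra
    ultimately have "s \<in> P" using P.a_closed by metis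
    then show False using * by simp
  qed
  have 5: "Q k \<subseteq> P" for k
  proof
    fix a assume "a \<in> Q k"
    then obtain s i r where *: "a \<in> carrier R" "s \<in> carrier R" "s \<notin> P" "i \<in> P0" "r \<in> carrier R"
      "s \<otimes> a = i \<oplus> r \<otimes> y [^] Suc k" unfolding memQ by blast
    have "y [^] Suc k \<in> P" using y by (simp add: P.I_l_closed)
    then have "s \<otimes> a \<in> P" unfolding *(6) using * \<open>P0 \<subset> P\<close> P.I_l_closed by (intro P.a_closed) auto
    then show "a \<in> P" using P.I_prime * by blast
  qed
  show ?thesis
    using that[of Q] 1 2 3 4 5 by blast
qed

section \<open>The principal ideal theorem and minimal generators\<close>

lemma (in ideal) finsum_mem:
  assumes "\<And>k. k \<in> A \<Longrightarrow> f k \<in> I"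
  shows "(\<Oplus>k\<in>A. f k) \<in> I"
  using assms
proof (induction A rule: infinite_finite_induct)
  case (insert a A)
  then have "f \<in> A \<rightarrow> carrier R" "f a \<in> carrier R" using Icarr by blast+
  then show ?case using insert by simp
qed simp_all

section \<open>Nakayama's lemma for saturated ideals\<close>

locale noetherian_cring = noetherian_ring + cring
begin

text \<open>The assumption \<open>step\<close> says that \<open>M\<close> equals
  \<open>N + z M\<close> after localising at \<open>P\<close>. Instead of a determinant, the proof
  takes a maximal saturated ideal \<open>J\<close> with \<open>N \<subseteq> J \<subset> M\<close>:
  modulo \<open>J\<close>, the ideal \<open>M\<close> is locally generated by a single element
  \<open>g\<close>, so one relation decides.\<close>

lemma saturated_nakayama:
  assumes P: "primeideal P R" and N: "saturated_ideal R P N" and M: "saturated_ideal R P M"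
    and "N \<subseteq> M" "z \<in> P"
    and step: "\<And>a. a \<in> M \<Longrightarrow> \<exists>s\<in>carrier R - P. \<exists>n\<in>N. \<exists>b\<in>M. s \<otimes> a = n \<oplus> z \<otimes> b"
  shows "M \<subseteq> N"
proof (rule ccontr)
  interpret P: primeideal P R by fact
  interpret M: ideal M R using M by (rule saturated_idealD)
  assume "\<not> M \<subseteq> N"
  then have "N \<in> {I. saturated_ideal R P I \<and> N \<subseteq> I \<and> I \<subset> M}" (is "_ \<in> ?F") using N \<open>N \<subseteq> M\<close> by blast
  then have "\<exists>J\<in>?F. \<forall>I\<in>?F. J \<subseteq> I \<longrightarrow> I = J"
    by (intro ex_maximal_ideal_in) (auto simp: saturated_idealD)
  then obtain J where J: "saturated_ideal R P J" "N \<subseteq> J" "J \<subset> M"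
    and Jmax: "\<forall>I\<in>?F. J \<subseteq> I \<longrightarrow> I = J"
    by blast
  have max: "I = J" if "saturated_ideal R P I" "N \<subseteq> I" "I \<subset> M" "J \<subseteq> I" for I
    using Jmax that by blast
  interpret J: ideal J R using J(1) by (rule saturated_idealD)
  obtain g where g: "g \<in> M" "g \<notin> J" using J by auto
  define K where "K = saturation R P (ideal_adjoin R J g)"
  have gR: "g \<in> carrier R" using g by (simp add: M.Icarr)
  have K: "saturated_ideal R P K" "ideal_adjoin R J g \<subseteq> K"
    unfolding K_def by (intro saturated_ideal_saturation saturation_superset ideal_ideal_adjoin
        J.is_ideal gR P)+
  have JK: "J \<subseteq> K" "g \<in> K" using ideal_adjoin_superset[OF J.is_ideal gR] K by auto
  have "K \<subseteq> M"
  proof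
    fix a assume "a \<in> K"
    then obtain s j r where *: "a \<in> carrier R" "s \<in> carrier R" "s \<notin> P" "j \<in> J" "r \<in> carrier R"
      "s \<otimes> a = j \<oplus> r \<otimes> g"
      by (auto simp: K_def saturation_def mem_ideal_adjoin_iff)
    then have "s \<otimes> a \<in> M" using J g by (auto simp: M.I_l_closed)
    then show "a \<in> M" using saturated_idealD(2)[OF M, of a s] * by simp
  qed
  with max[OF K(1)] JK J(2) g have KM: "K = M" by blast
  obtain s n b where s: "s \<in> carrier R" "s \<notin> P" "n \<in> N" "b \<in> M" "s \<otimes> g = n \<oplus> z \<otimes> b"
    using step[OF g(1)] by auto
  obtain t j r where t: "t \<in> carrier R" "t \<notin> P" "j \<in> J" "r \<in> carrier R" "t \<otimes> b = j \<oplus> r \<otimes> g"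
    using s(4) unfolding KM[symmetric] by (auto simp: K_def saturation_def mem_ideal_adjoin_iff)
  have nJ: "n \<in> J" using s J by auto
  have car: "z \<in> carrier R" "n \<in> carrier R" "b \<in> carrier R" "j \<in> carrier R"
    using \<open>z \<in> P\<close> nJ s t by (simp_all add: J.Icarr M.Icarr P.Icarr)
  \<comment> \<open>Eliminating \<open>b\<close> from the two relations leaves a multiple of
    \<open>g\<close> in \<open>J\<close>. Its factor is outside \<open>P\<close>, because
    \<open>z\<close> is in \<open>P\<close> while \<open>s\<close> and \<open>t\<close> are not;
    saturation then puts \<open>g\<close> itself into \<open>J\<close>.\<close>
  have "(t \<otimes> s \<ominus> z \<otimes> r) \<otimes> g = t \<otimes> (s \<otimes> g) \<ominus> z \<otimes> (r \<otimes> g)"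
    using s(1) t(1,4) car gR by algebra
  also have "\<dots> = t \<otimes> n \<oplus> (z \<otimes> (t \<otimes> b) \<ominus> z \<otimes> (r \<otimes> g))" unfolding s(5) using s(1) t(1,4) car gR by algebra
  also have "\<dots> = t \<otimes> n \<oplus> z \<otimes> j" unfolding t(5) using s(1) t(1,4) car gR by algebra
  also have "\<dots> \<in> J" using nJ t car by (simp add: J.I_l_closed)
  finally have 1: "(t \<otimes> s \<ominus> z \<otimes> r) \<otimes> g \<in> J" .
  have "t \<otimes> s \<ominus> z \<otimes> r \<notin> P"
  proof
    assume *: "t \<otimes> s \<ominus> z \<otimes> r \<in> P"
    have "t \<otimes> s = (t \<otimes> s \<ominus> z \<otimes> r) \<oplus> z \<otimes> r" using s(1) t(1,4) car by algebra
    also have "\<dots> \<in> P" using * \<open>z \<in> P\<close> t by (simp add: P.I_r_closed)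
    finally show False using P.I_prime s t by blast
  qed
  then have "g \<in> J" using saturated_idealD(2)[OF J(1) gR _ _ 1] s(1) t(1,4) car by simp
  then show False using g by simp
qed

text \<open>The element \<open>y\<close> stays outside \<open>N + (z)\<close> even after localising
  at \<open>Q\<close>. Otherwise every \<open>a\<close> in \<open>M\<close> has a relation
  \<open>s a = n + z r\<close> with arbitrary \<open>r\<close>. Then \<open>z r\<close> is in
  \<open>M\<close>, and since \<open>z\<close> is outside \<open>P\<close>, saturation of
  \<open>M\<close> at \<open>P\<close> gives \<open>r\<close> in \<open>M\<close>. This is the input
  of Nakayama's lemma at \<open>Q\<close>, which would yield \<open>M \<subseteq> N\<close>.\<close>

lemma saturated_ex_not_mem:
  assumes P: "primeideal P R" and Q: "primeideal Q R" "P \<subseteq> Q" and z: "z \<in> Q" "z \<notin> P"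
    and N: "saturated_ideal R P N" and M: "saturated_ideal R P M" and "N \<subset> M"
  obtains y where "y \<in> M"
    "\<And>s n r. \<lbrakk>s \<in> carrier R; s \<notin> Q; n \<in> N; r \<in> carrier R\<rbrakk> \<Longrightarrow> s \<otimes> y \<noteq> n \<oplus> z \<otimes> r"
proof (rule ccontr)
  interpret M: ideal M R using M by (rule saturated_idealD)
  interpret Q: primeideal Q R by fact
  note that_y = that
  assume no: "\<not> thesis"
  have *: "\<exists>s n r. s \<in> carrier R \<and> s \<notin> Q \<and> n \<in> N \<and> r \<in> carrier R \<and> s \<otimes> a = n \<oplus> z \<otimes> r"
    if a: "a \<in> M" for a
  proof (rule ccontr)
    assume "\<not> ?thesis"
    then have thesis by (intro that_y[OF a]) blast
    with no show False ..
  qed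
  have "M \<subseteq> N"
  proof (rule saturated_nakayama[OF Q(1) _ _ _ z(1)])
    fix a assume a: "a \<in> M"
    obtain s n r where s: "s \<in> carrier R" "s \<notin> Q" "n \<in> N" "r \<in> carrier R" "s \<otimes> a = n \<oplus> z \<otimes> r"
      using *[OF a] by blast
    have "n \<in> M" using s \<open>N \<subset> M\<close> by auto
    have car: "n \<in> carrier R" "a \<in> carrier R" "z \<in> carrier R"
      using \<open>n \<in> M\<close> a z by (simp_all add: M.Icarr Q.Icarr)
    have "z \<otimes> r \<oplus> n = s \<otimes> a" unfolding s(5) by (rule a_comm) (use s(4) car in simp_all)
    also have "\<dots> \<in> M" by (rule M.I_l_closed[OF a s(1)])
    finally have "z \<otimes> r \<oplus> n \<in> M" .
    then have "z \<otimes> r \<in> M"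
      by (rule ideal_add_cancel[OF M.is_ideal m_closed[OF car(3) s(4)] \<open>n \<in> M\<close>])
    then have "r \<in> M" by (rule saturated_idealD(2)[OF M s(4) car(3) z(2)])
    with s show "\<exists>s\<in>carrier R - Q. \<exists>n\<in>N. \<exists>b\<in>M. s \<otimes> a = n \<oplus> z \<otimes> b" by blast
  qed (use N M \<open>P \<subseteq> Q\<close> \<open>N \<subset> M\<close> in \<open>auto intro: saturated_ideal_antimono\<close>)
  then show False using \<open>N \<subset> M\<close> by blast
qed

section \<open>Descending chains over a minimal prime\<close>

lemma saturated_ideal_colon:
  assumes I: "saturated_ideal R P I" and a: "a \<in> carrier R"
  shows "saturated_ideal R P {r \<in> carrier R. r \<otimes> a \<in> I}"
  unfolding saturated_ideal_def
proof (intro conjI ballI impI)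
  interpret I: ideal I R using I by (rule saturated_idealD)
  show "ideal {r \<in> carrier R. r \<otimes> a \<in> I} R"
  proof (rule idealI[OF ring_axioms])
    show "subgroup {r \<in> carrier R. r \<otimes> a \<in> I} (add_monoid R)"
    proof (rule add.subgroupI)
      have "\<zero> \<in> {r \<in> carrier R. r \<otimes> a \<in> I}" using a by simp
      then show "{r \<in> carrier R. r \<otimes> a \<in> I} \<noteq> {}" by blast
    next
      fix r assume "r \<in> {r \<in> carrier R. r \<otimes> a \<in> I}"
      then show "\<ominus> r \<in> {r \<in> carrier R. r \<otimes> a \<in> I}" using a by (simp add: l_minus)
    next
      fix r t assume "r \<in> {r \<in> carrier R. r \<otimes> a \<in> I}" "t \<in> {r \<in> carrier R. r \<otimes> a \<in> I}"
      then show "r \<oplus> t \<in> {r \<in> carrier R. r \<otimes> a \<in> I}" using a by (simp add: l_distr)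
    qed blast
  next
    fix r x assume r: "r \<in> {r \<in> carrier R. r \<otimes> a \<in> I}" and x: "x \<in> carrier R"
    have "x \<otimes> (r \<otimes> a) \<in> I" using r x by (simp add: I.I_l_closed)
    moreover have "x \<otimes> (r \<otimes> a) = (x \<otimes> r) \<otimes> a" "x \<otimes> r = r \<otimes> x"
      using r x a by (simp_all add: m_ac)
    ultimately show "x \<otimes> r \<in> {r \<in> carrier R. r \<otimes> a \<in> I}" "r \<otimes> x \<in> {r \<in> carrier R. r \<otimes> a \<in> I}"
      using r x by simp_all
  qed
next
  fix r s assume r: "r \<in> carrier R" and s: "s \<in> carrier R - P"
    and rs: "s \<otimes> r \<in> {r \<in> carrier R. r \<otimes> a \<in> I}"
  have "s \<otimes> (r \<otimes> a) = (s \<otimes> r) \<otimes> a" using r s a by (simp add: m_assoc)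
  then have "r \<otimes> a \<in> I" using saturated_idealD(2)[OF I, of "r \<otimes> a" s] r s a rs by simp
  then show "r \<in> {r \<in> carrier R. r \<otimes> a \<in> I}" using r by simp
qed

text \<open>Noetherian induction: an ideal that is maximal among those above which stability fails is prime,
  because a descending chain \<open>J k\<close> is determined by the chains \<open>J k : a\<close> and \<open>J k + (a)\<close>.\<close>

lemma saturated_descending_stable:
  fixes J :: "nat \<Rightarrow> 'a set"
  assumes P: "primeideal P R" and I0: "ideal I0 R"
    and only: "\<And>Q. primeideal Q R \<Longrightarrow> I0 \<subseteq> Q \<Longrightarrow> Q \<subseteq> P \<Longrightarrow> Q = P"
    and J: "\<And>k. saturated_ideal R P (J k)" "\<And>k. I0 \<subseteq> J k" "\<And>k. J (Suc k) \<subseteq> J k"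
  shows "\<exists>K. \<forall>k\<ge>K. J k = J K"
proof (rule ccontr)
  \<comment> \<open>All chains above \<open>T\<close> are quantified over, because the maximality of
    \<open>T\<close> is applied to the auxiliary chains \<open>A\<close> and \<open>B\<close> rather
    than to \<open>J\<close>.\<close>
  define stable where "stable T \<longleftrightarrow> (\<forall>J :: nat \<Rightarrow> 'a set.
    (\<forall>k. saturated_ideal R P (J k) \<and> T \<subseteq> J k \<and> J (Suc k) \<subseteq> J k) \<longrightarrow> (\<exists>K. \<forall>k\<ge>K. J k = J K))" for T
  interpret P: primeideal P R by fact
  assume "\<not> ?thesis"
  then have "I0 \<in> {T. ideal T R \<and> I0 \<subseteq> T \<and> \<not> stable T}" (is "_ \<in> ?F")
    using I0 J unfolding stable_def by blast
  then have "\<exists>T\<in>?F. \<forall>I\<in>?F. T \<subseteq> I \<longrightarrow> I = T"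
    by (intro ex_maximal_ideal_in) auto
  then obtain T where T: "ideal T R" "I0 \<subseteq> T" "\<not> stable T"
    and Tmax: "\<forall>I\<in>?F. T \<subseteq> I \<longrightarrow> I = T"
    by auto
  have max: "stable U" if "ideal U R" "T \<subset> U" for U
    using Tmax T(2) that by blast
  interpret T: ideal T R by fact
  obtain J where J: "\<And>k. saturated_ideal R P (J k)" "\<And>k. T \<subseteq> J k" "\<And>k. J (Suc k) \<subseteq> J k"
    and unstable: "\<nexists>K. \<forall>k\<ge>K. J k = J K"
    using T(3) unfolding stable_def by blast
  have Jid: "ideal (J k) R" for k using J by (intro saturated_idealD)
  have Jmono: "J l \<subseteq> J k" if "k \<le> l" for k l
    using lift_Suc_antimono_le[of J k l] J(3) that by blast
  have XP: "T \<subseteq> P"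
  proof
    fix s assume s: "s \<in> T"
    show "s \<in> P"
    proof (rule ccontr)
      assume "s \<notin> P"
      then have "\<one> \<in> J k" for k
        using saturated_idealD(2)[OF J(1)[of k], of \<one> s] J(2)[of k] s by (auto simp: T.Icarr)
      then have "J k = carrier R" for k
        using ideal.one_imp_carrier[OF Jid[of k]] by blast
      then show False using unstable by simp
    qed
  qed
  have "primeideal T R"
  proof (rule primeidealI[OF T.is_ideal is_cring])
    show "carrier R \<noteq> T" using XP P.I_notcarr P.Icarr by auto
    fix a b assume a: "a \<in> carrier R" and b: "b \<in> carrier R" and ab: "a \<otimes> b \<in> T"
    show "a \<in> T \<or> b \<in> T"
    proof (rule ccontr)
      assume *: "\<not> (a \<in> T \<or> b \<in> T)"
      define A where "A k = {r \<in> carrier R. r \<otimes> a \<in> J k}" for k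
      define B where "B k = saturation R P (ideal_adjoin R (J k) a)" for k
      have st: "stable (ideal_adjoin R T c)" if "c \<in> carrier R" "c \<notin> T" for c
        using max[OF ideal_ideal_adjoin] ideal_adjoin_superset[OF T(1)] that T(1) by blast
      have A: "\<exists>K. \<forall>k\<ge>K. A k = A K"
      proof -
        \<comment> \<open>Since \<open>a \<otimes> b\<close> is in \<open>T\<close>, the ideals
          \<open>J k : a\<close> contain \<open>b\<close> as well as \<open>T\<close>. So they form
          a chain over a strictly larger ideal.\<close>
        have "r \<otimes> a \<in> J k" if "r \<in> ideal_adjoin R T b" for r k
        proof -
          obtain i t where r: "i \<in> T" "t \<in> carrier R" "r = i \<oplus> t \<otimes> b"
            using \<open>r \<in> ideal_adjoin R T b\<close> unfolding mem_ideal_adjoin_iff by blast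
          have "r \<otimes> a = i \<otimes> a \<oplus> t \<otimes> (a \<otimes> b)"
            unfolding r(3) using r(2) a b T.Icarr[OF r(1)] by algebra
          also have "\<dots> \<in> T" using r a ab T.I_l_closed T.I_r_closed by simp
          finally show ?thesis using J(2) by blast
        qed
        moreover have "ideal_adjoin R T b \<subseteq> carrier R"
          using ideal_ideal_adjoin[OF T(1) b] by (simp add: ideal.Icarr subsetI)
        ultimately have "ideal_adjoin R T b \<subseteq> A k" for k by (auto simp: A_def)
        moreover have "A (Suc k) \<subseteq> A k" for k using J(3) by (auto simp: A_def)
        moreover have "saturated_ideal R P (A k)" for k
          unfolding A_def by (rule saturated_ideal_colon[OF J(1) a])
        ultimately show ?thesis using st[OF b] * unfolding stable_def by blast
      qed
      have B: "\<exists>K. \<forall>k\<ge>K. B k = B K"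
      proof -
        have "ideal_adjoin R T a \<subseteq> ideal_adjoin R (J k) a" for k
          using J(2) by (rule ideal_adjoin_mono)
        then have "ideal_adjoin R T a \<subseteq> B k" for k
          using saturation_superset[OF P ideal_ideal_adjoin[OF Jid a], of k] unfolding B_def by blast
        moreover have "B (Suc k) \<subseteq> B k" for k
          using J(3)[of k] unfolding B_def saturation_def by (fastforce simp: mem_ideal_adjoin_iff)
        moreover have "saturated_ideal R P (B k)" for k
          unfolding B_def by (intro saturated_ideal_saturation P ideal_ideal_adjoin Jid a)
        ultimately show ?thesis using st[OF a] * unfolding stable_def by blast
      qed
      obtain K1 K2 where K1: "\<And>k. k \<ge> K1 \<Longrightarrow> A k = A K1" and K2: "\<And>k. k \<ge> K2 \<Longrightarrow> B k = B K2"
        using A B by blast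
      define K where "K = max K1 K2"
      \<comment> \<open>An element \<open>u\<close> of \<open>J K\<close> lies in
        \<open>B k\<close>, so \<open>s u = v + r a\<close> with \<open>v\<close> in
        \<open>J k\<close>. Then \<open>r a\<close> is in \<open>J K\<close>, so \<open>r\<close> is
        in \<open>A K = A k\<close>, which returns \<open>r a\<close>, and with it
        \<open>s u\<close>, to \<open>J k\<close>.\<close>
      have "J k = J K" if k: "k \<ge> K" for k
      proof
        show "J k \<subseteq> J K" by (rule Jmono[OF k])
        show "J K \<subseteq> J k"
        proof
          fix u assume u: "u \<in> J K"
          then have uR: "u \<in> carrier R" by (rule ideal.Icarr[OF Jid])
          have "u \<in> B K" using u saturation_superset[OF P ideal_ideal_adjoin[OF Jid[of K] a]]
              ideal_adjoin_superset(1)[OF Jid[of K] a] unfolding B_def by blast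
          also have "B K = B k" using K2[of K] K2[of k] k by (simp add: K_def)
          finally obtain s v r where s: "s \<in> carrier R" "s \<notin> P" "v \<in> J k" "r \<in> carrier R"
            "s \<otimes> u = v \<oplus> r \<otimes> a"
            by (auto simp: B_def saturation_def mem_ideal_adjoin_iff)
          have vR: "v \<in> carrier R" by (rule ideal.Icarr[OF Jid s(3)])
          have "r \<otimes> a \<oplus> v = s \<otimes> u" unfolding s(5) using s(4) vR a by (simp add: a_comm)
          also have "\<dots> \<in> J K" by (rule ideal.I_l_closed[OF Jid u s(1)])
          finally have "r \<otimes> a \<oplus> v \<in> J K" .
          moreover have "v \<in> J K" using s(3) Jmono[OF k] by blast
          ultimately have "r \<otimes> a \<in> J K"
            using ideal_add_cancel[OF Jid m_closed[OF s(4) a]] by blast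
          then have "r \<in> A K" using s by (simp add: A_def)
          also have "A K = A k" using K1[of K] K1[of k] k by (simp add: K_def)
          finally have "r \<otimes> a \<in> J k" by (simp add: A_def)
          then have "s \<otimes> u \<in> J k" unfolding s(5) by (rule ideal_add_closed[OF Jid s(3)])
          then show "u \<in> J k" using saturated_idealD(2)[OF J(1) uR s(1,2)] by simp
        qed
      qed
      then show False using unstable by blast
    qed
  qed
  then have "T = P" using only T XP by blast
  \<comment> \<open>Localising at \<open>P\<close> and dividing by \<open>P\<close> gives a field,
    so two values remain and the chain can drop at most once.\<close>
  have "J k = P \<or> J k = carrier R" for k
  proof (cases "J k \<subseteq> P")
    case False
    then obtain s where "s \<in> J k" "s \<notin> P" by blast
    then have "\<one> \<in> J k"
      using saturated_idealD(2)[OF J(1)[of k], of \<one> s] ideal.Icarr[OF Jid[of k]] by auto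
    then show ?thesis using ideal.one_imp_carrier[OF Jid[of k]] by blast
  qed (use J(2) \<open>T = P\<close> in auto)
  then have *: "J k = P \<or> J k = carrier R" for k .
  show False
  proof (cases "\<exists>K. J K = P")
    case True
    then obtain K where "J K = P" by blast
    then have "J k = J K" if "k \<ge> K" for k using Jmono[OF that] J(2)[of k] \<open>T = P\<close> by auto
    then show False using unstable by blast
  next
    case False
    then show False using * unstable by metis
  qed
qed

text \<open>Krull's principal ideal theorem modulo \<open>P0\<close>. If \<open>P2\<close> were
  minimal over \<open>P0 + (x)\<close>, the chain of the ideals \<open>Q k + (x)\<close>, saturated
  at \<open>P2\<close>, would become stationary. The ideals \<open>Q k\<close> between
  \<open>P0\<close> and \<open>P1\<close> play the part of the symbolic powers in the usual
  proof.\<close>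

lemma ex_prime_between:
  assumes P0: "primeideal P0 R" and P1: "primeideal P1 R" and P2: "primeideal P2 R"
    and "P0 \<subset> P1" "P1 \<subset> P2" "x \<in> P2"
  obtains Q where "primeideal Q R" "P0 \<subseteq> Q" "x \<in> Q" "Q \<subset> P2"
proof (rule ccontr)
  assume "\<not> thesis"
  with that have none: "Q = P2" if "primeideal Q R" "P0 \<subseteq> Q" "x \<in> Q" "Q \<subseteq> P2" for Q
    using \<open>primeideal Q R\<close> \<open>P0 \<subseteq> Q\<close> \<open>x \<in> Q\<close> \<open>Q \<subseteq> P2\<close> by blast
  have P0id: "ideal P0 R" using P0 by (rule primeideal.axioms)
  have xR: "x \<in> carrier R" using \<open>x \<in> P2\<close> ideal.Icarr[OF primeideal.axioms(1)[OF P2]] by blast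
  have "x \<notin> P1" using none[OF P1] assms by blast
  obtain Q where Q: "\<And>k. saturated_ideal R P1 (Q k)" "\<And>k. P0 \<subseteq> Q k"
    "\<And>k. Q (Suc k) \<subset> Q k"
    using ex_descending_saturated_ideals[OF P0 P1 \<open>P0 \<subset> P1\<close>] by metis
  have Qid: "ideal (Q k) R" for k using Q by (intro saturated_idealD)
  define J where "J k = saturation R P2 (ideal_adjoin R (Q k) x)" for k
  have "\<exists>K. \<forall>k\<ge>K. J k = J K"
  proof (rule saturated_descending_stable[OF P2 ideal_ideal_adjoin[OF P0id xR]])
    fix k
    show "saturated_ideal R P2 (J k)"
      unfolding J_def by (intro saturated_ideal_saturation P2 ideal_ideal_adjoin Qid xR)
    have "ideal_adjoin R P0 x \<subseteq> ideal_adjoin R (Q k) x" using Q(2) by (rule ideal_adjoin_mono)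
    then show "ideal_adjoin R P0 x \<subseteq> J k"
      using saturation_superset[OF P2 ideal_ideal_adjoin[OF Qid xR], of k] unfolding J_def by blast
    show "J (Suc k) \<subseteq> J k"
      using Q(3)[of k] unfolding J_def saturation_def by (fastforce simp: mem_ideal_adjoin_iff)
  next
    fix Q assume "primeideal Q R" "ideal_adjoin R P0 x \<subseteq> Q" "Q \<subseteq> P2"
    then show "Q = P2" using none ideal_adjoin_superset[OF P0id xR] by blast
  qed
  then obtain K where K: "J (Suc K) = J K" by (metis le_Suc_eq order_refl)
  \<comment> \<open>The strict step from \<open>Q (Suc K)\<close> to \<open>Q K\<close> remains
    visible after adding \<open>x\<close>, since \<open>x\<close> is outside \<open>P1\<close>. This
    contradicts \<open>J (Suc K) = J K\<close>.\<close>
  obtain y where y: "y \<in> Q K"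
    "\<And>s n r. \<lbrakk>s \<in> carrier R; s \<notin> P2; n \<in> Q (Suc K); r \<in> carrier R\<rbrakk> \<Longrightarrow> s \<otimes> y \<noteq> n \<oplus> x \<otimes> r"
    using saturated_ex_not_mem[OF P1 P2 _ \<open>x \<in> P2\<close> \<open>x \<notin> P1\<close> Q(1) Q(1) Q(3)] \<open>P1 \<subset> P2\<close> by blast
  have "y \<in> J K" using y(1) saturation_superset[OF P2 ideal_ideal_adjoin[OF Qid[of K] xR]]
      ideal_adjoin_superset(1)[OF Qid[of K] xR] unfolding J_def by blast
  then obtain s n r where s: "s \<in> carrier R" "s \<notin> P2" "n \<in> Q (Suc K)" "r \<in> carrier R"
    "s \<otimes> y = n \<oplus> r \<otimes> x"
    unfolding K[symmetric] by (auto simp: J_def saturation_def mem_ideal_adjoin_iff)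
  then show False using y(2)[OF s(1-4)] by (simp add: m_comm[OF s(4) xR])
qed

text \<open>Each induction step multiplies the old elements by \<open>z\<close> and adds one
  \<open>y\<close> from \<open>Q N\<close>. In a relation modulo \<open>Q (Suc N)\<close> the choice
  of \<open>y\<close> forces its coefficient into \<open>M\<close>. What is left says that
  \<open>z w\<close> is in \<open>Q N\<close>; as \<open>z\<close> is outside \<open>P\<close>, it
  cancels and the induction hypothesis applies to \<open>w\<close>.\<close>

lemma ex_independent_family:
  assumes P0: "primeideal P0 R" and P: "primeideal P R" and M: "primeideal M R"
    and "P0 \<subset> P" "P \<subset> M"
  shows "\<exists>Q. saturated_ideal R P Q \<and> P0 \<subseteq> Q \<and> (\<exists>f\<in>{..<N::nat} \<rightarrow> M. \<forall>c\<in>{..<N} \<rightarrow> carrier R.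
    (\<Oplus>k\<in>{..<N}. c k \<otimes> f k) \<in> Q \<longrightarrow> c \<in> {..<N} \<rightarrow> M)"
proof -
  interpret M: primeideal M R by fact
  obtain z where z: "z \<in> M" "z \<notin> P" using \<open>P \<subset> M\<close> by blast
  have zR: "z \<in> carrier R" using z by (simp add: M.Icarr)
  obtain Q where Q: "\<And>k. saturated_ideal R P (Q k)" "\<And>k. P0 \<subseteq> Q k"
    "\<And>k. Q (Suc k) \<subset> Q k" "\<And>k. Q k \<subseteq> P"
    using ex_descending_saturated_ideals[OF P0 P \<open>P0 \<subset> P\<close>] by metis
  have Qid: "ideal (Q k) R" for k using Q by (intro saturated_idealD)
  \<comment> \<open>Relations modulo \<open>Q N\<close> are needed, not just relations equal to
    zero: cancelling \<open>z\<close> leaves \<open>w\<close> in \<open>Q N\<close>, with no claim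
    that \<open>w\<close> vanishes.\<close>
  have "\<exists>f\<in>{..<N} \<rightarrow> M. \<forall>c\<in>{..<N} \<rightarrow> carrier R.
      (\<Oplus>k\<in>{..<N}. c k \<otimes> f k) \<in> Q N \<longrightarrow> c \<in> {..<N} \<rightarrow> M" for N
  proof (induction N)
    case 0
    then show ?case by simp
  next
    case (Suc N)
    then obtain f where f: "f \<in> {..<N} \<rightarrow> M" and indep: "\<And>c. c \<in> {..<N} \<rightarrow> carrier R \<Longrightarrow>
        (\<Oplus>k\<in>{..<N}. c k \<otimes> f k) \<in> Q N \<Longrightarrow> c \<in> {..<N} \<rightarrow> M" by blast
    obtain y where y: "y \<in> Q N" "\<And>s n r. \<lbrakk>s \<in> carrier R; s \<notin> M; n \<in> Q (Suc N); r \<in> carrier R\<rbrakk>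
        \<Longrightarrow> s \<otimes> y \<noteq> n \<oplus> z \<otimes> r"
      using saturated_ex_not_mem[OF P M _ z Q(1) Q(1) Q(3)[of N]] \<open>P \<subset> M\<close> by blast
    have yM: "y \<in> M" using y Q(4) \<open>P \<subset> M\<close> by blast
    have yR: "y \<in> carrier R" using yM by (simp add: M.Icarr)
    have fR: "f \<in> {..<N} \<rightarrow> carrier R" using f M.Icarr by blast
    define g where "g k = (if k < N then z \<otimes> f k else y)" for k
    show ?case
    proof (intro bexI[of _ g] ballI impI)
      show "g \<in> {..<Suc N} \<rightarrow> M" using f yM zR by (auto simp: g_def intro!: M.I_l_closed)
      fix c assume c: "c \<in> {..<Suc N} \<rightarrow> carrier R"
        and rel: "(\<Oplus>k\<in>{..<Suc N}. c k \<otimes> g k) \<in> Q (Suc N)"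
      have cR: "c \<in> {..<N} \<rightarrow> carrier R" "c N \<in> carrier R" using c by auto
      define w where "w = (\<Oplus>k\<in>{..<N}. c k \<otimes> f k)"
      have wR: "w \<in> carrier R" unfolding w_def using cR fR by (intro finsum_closed) auto
      have "(\<Oplus>k\<in>{..<N}. c k \<otimes> g k) = (\<Oplus>k\<in>{..<N}. z \<otimes> (c k \<otimes> f k))"
      proof (rule finsum_cong')
        fix k assume "k \<in> {..<N}"
        moreover have "c k \<in> carrier R" "f k \<in> carrier R" using calculation cR fR by auto
        ultimately show "c k \<otimes> g k = z \<otimes> (c k \<otimes> f k)" using zR by (simp add: g_def m_lcomm)
      qed (use cR fR zR in auto)
      also have "\<dots> = z \<otimes> w"
        unfolding w_def using cR fR zR by (intro finsum_rdistr[symmetric]) auto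
      finally have "(\<Oplus>k\<in>{..<N}. c k \<otimes> g k) = z \<otimes> w" .
      then have "(\<Oplus>k\<in>{..<Suc N}. c k \<otimes> g k) = c N \<otimes> y \<oplus> z \<otimes> w"
        using cR fR zR yR by (simp add: lessThan_Suc g_def Pi_def)
      with rel have rel: "c N \<otimes> y \<oplus> z \<otimes> w \<in> Q (Suc N)" by simp
      have cM: "c N \<in> M"
      proof (rule ccontr)
        assume "c N \<notin> M"
        moreover have "c N \<otimes> y = (c N \<otimes> y \<oplus> z \<otimes> w) \<oplus> z \<otimes> (\<ominus> w)"
          using cR yR zR wR by algebra
        ultimately show False using y(2)[OF cR(2) _ rel, of "\<ominus> w"] wR by simp
      qed
      have "c N \<otimes> y \<in> Q N" by (rule ideal.I_l_closed[OF Qid y(1) cR(2)])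
      moreover have "z \<otimes> w \<oplus> c N \<otimes> y \<in> Q N"
        using rel Q(3)[of N] cR yR zR wR by (auto simp: a_comm[of "z \<otimes> w"])
      ultimately have "z \<otimes> w \<in> Q N"
        by (rule ideal_add_cancel[OF Qid m_closed[OF zR wR]])
      then have "w \<in> Q N" using saturated_idealD(2)[OF Q(1) wR zR z(2)] by simp
      then have "c \<in> {..<N} \<rightarrow> M" using indep[OF cR(1)] by (simp add: w_def)
      then show "c \<in> {..<Suc N} \<rightarrow> M" using cM by (auto simp: lessThan_Suc)
    qed
  qed
  then show ?thesis by (intro exI[of _ "Q N"] conjI Q)
qed

text \<open>A maximal element among the saturated ideals strictly below \<open>M\<close> works. It replaces the square of
  \<open>M\<close> in the main argument.\<close>

lemma ex_saturated_ideal_square_subset: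
  assumes M: "primeideal M R" and P: "primeideal P R" "P \<subset> M"
  obtains J where "saturated_ideal R M J" "J \<subset> M"
    "\<And>a b. a \<in> M \<Longrightarrow> b \<in> M \<Longrightarrow> a \<otimes> b \<in> J"
proof -
  interpret M: primeideal M R by fact
  have "P \<in> {I. saturated_ideal R M I \<and> I \<subset> M}" (is "_ \<in> ?F")
    using P saturated_ideal_prime by blast
  then have "\<exists>J\<in>?F. \<forall>I\<in>?F. J \<subseteq> I \<longrightarrow> I = J"
    by (intro ex_maximal_ideal_in) (auto simp: saturated_idealD)
  then obtain J where J: "saturated_ideal R M J" "J \<subset> M"
    and max: "\<And>I. saturated_ideal R M I \<Longrightarrow> I \<subset> M \<Longrightarrow> J \<subseteq> I \<Longrightarrow> I = J"
    by auto
  interpret J: ideal J R using J by (intro saturated_idealD)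
  \<comment> \<open>By maximality of \<open>J\<close>, any element of \<open>M\<close> outside
    \<open>J\<close> generates \<open>M\<close> modulo \<open>J\<close> after localising at
    \<open>M\<close>.\<close>
  have gen: "\<exists>s\<in>carrier R - M. \<exists>j\<in>J. \<exists>r\<in>carrier R. s \<otimes> a = j \<oplus> r \<otimes> g"
    if g: "g \<in> M" "g \<notin> J" and a: "a \<in> M" for g a
  proof -
    have gR: "g \<in> carrier R" using g by (simp add: M.Icarr)
    define I where "I = saturation R M (ideal_adjoin R J g)"
    have sat: "saturated_ideal R M I"
      unfolding I_def by (intro saturated_ideal_saturation M ideal_ideal_adjoin J.is_ideal gR)
    have sub: "J \<subseteq> I" "g \<in> I"
      using ideal_adjoin_superset[OF J.is_ideal gR]
        saturation_superset[OF M ideal_ideal_adjoin[OF J.is_ideal gR]] unfolding I_def by auto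
    have "I \<subseteq> M"
    proof
      fix b assume "b \<in> I"
      then obtain s j r where *: "b \<in> carrier R" "s \<in> carrier R" "s \<notin> M" "j \<in> J" "r \<in> carrier R"
        "s \<otimes> b = j \<oplus> r \<otimes> g" by (auto simp: I_def saturation_def mem_ideal_adjoin_iff)
      then have "s \<otimes> b \<in> M" using J(2) g by (auto simp: M.I_l_closed)
      then show "b \<in> M" using M.I_prime * by blast
    qed
    then have "I = M" using max[OF sat] sub g by blast
    then show ?thesis using a by (auto simp: I_def saturation_def mem_ideal_adjoin_iff)
  qed
  obtain x where x: "x \<in> M" "x \<notin> J" using J by blast
  have xR: "x \<in> carrier R" using x by (simp add: M.Icarr)
  \<comment> \<open>If \<open>x x\<close> were outside \<open>J\<close>, it would generate
    \<open>x\<close> modulo \<open>J\<close>, giving \<open>(s - r x) x\<close> in \<open>J\<close>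
    with \<open>s - r x\<close> outside \<open>M\<close>, hence \<open>x\<close> in
    \<open>J\<close>.\<close>
  have xx: "x \<otimes> x \<in> J"
  proof (rule ccontr)
    assume "x \<otimes> x \<notin> J"
    then obtain s j r where *: "s \<in> carrier R" "s \<notin> M" "j \<in> J" "r \<in> carrier R"
      "s \<otimes> x = j \<oplus> r \<otimes> (x \<otimes> x)"
      using gen[of "x \<otimes> x" x] x xR M.I_l_closed by blast
    have jR: "j \<in> carrier R" using * by (simp add: J.Icarr)
    have "(s \<ominus> r \<otimes> x) \<otimes> x = s \<otimes> x \<ominus> r \<otimes> (x \<otimes> x)" using *(1,4) xR by algebra
    also have "\<dots> = j" unfolding *(5) using *(1,4) xR jR by algebra
    finally have 1: "(s \<ominus> r \<otimes> x) \<otimes> x \<in> J" using * by simp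
    have "s \<ominus> r \<otimes> x \<notin> M"
    proof
      assume "s \<ominus> r \<otimes> x \<in> M"
      moreover have "r \<otimes> x \<in> M" using * x by (simp add: M.I_l_closed)
      ultimately have "(s \<ominus> r \<otimes> x) \<oplus> r \<otimes> x \<in> M" by simp
      moreover have "(s \<ominus> r \<otimes> x) \<oplus> r \<otimes> x = s" using *(1,4) xR by algebra
      ultimately show False using * by simp
    qed
    then show False using saturated_idealD(2)[OF J(1) xR _ _ 1] x(2) *(1,4) xR by simp
  qed
  have "a \<otimes> b \<in> J" if "a \<in> M" "b \<in> M" for a b
  proof -
    obtain s i r where s: "s \<in> carrier R" "s \<notin> M" "i \<in> J" "r \<in> carrier R" "s \<otimes> a = i \<oplus> r \<otimes> x"
      using gen[OF x \<open>a \<in> M\<close>] by blast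
    obtain t j q where t: "t \<in> carrier R" "t \<notin> M" "j \<in> J" "q \<in> carrier R" "t \<otimes> b = j \<oplus> q \<otimes> x"
      using gen[OF x \<open>b \<in> M\<close>] by blast
    have car: "a \<in> carrier R" "b \<in> carrier R" "i \<in> carrier R" "j \<in> carrier R"
      using that s t by (simp_all add: M.Icarr J.Icarr)
    have "(s \<otimes> t) \<otimes> (a \<otimes> b) = (s \<otimes> a) \<otimes> (t \<otimes> b)" using s(1) t(1) car by algebra
    also have "\<dots> = i \<otimes> (j \<oplus> q \<otimes> x) \<oplus> ((r \<otimes> x) \<otimes> j \<oplus> (r \<otimes> q) \<otimes> (x \<otimes> x))"
      unfolding s(5) t(5) using s(1,4) t(1,4) car xR by algebra
    also have "\<dots> \<in> J" using s(3,4) t(3,4) car xR xx by (simp add: J.I_l_closed J.I_r_closed)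
    finally have 1: "(s \<otimes> t) \<otimes> (a \<otimes> b) \<in> J" .
    have "s \<otimes> t \<notin> M" using M.I_prime s(1,2) t(1,2) by blast
    then show ?thesis using saturated_idealD(2)[OF J(1) _ _ _ 1] s(1) t(1) car by simp
  qed
  then show ?thesis using that J by blast
qed

text \<open>The last member is an \<open>x\<close> in \<open>P 3\<close> outside \<open>J\<close>;
  the others are independent modulo an ideal containing \<open>x\<close>. A relation is therefore
  read twice: modulo that ideal for the first \<open>N\<close> coefficients, then modulo
  \<open>J\<close> for the coefficient of \<open>x\<close>.\<close>

lemma ex_minimal_generators:
  assumes P: "\<And>i. i \<le> 3 \<Longrightarrow> primeideal (P i) R" "\<And>i. i < 3 \<Longrightarrow> P i \<subset> P (Suc i)"
  shows "\<exists>J. saturated_ideal R (P 3) J \<and> (\<forall>a\<in>P 3. \<forall>b\<in>P 3. a \<otimes> b \<in> J) \<and>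
    (\<exists>f\<in>{..N::nat} \<rightarrow> carrier R. f N \<notin> J \<and> (\<forall>c\<in>{..N} \<rightarrow> carrier R.
      (\<Oplus>k\<in>{..N}. c k \<otimes> f k) = \<zero> \<longrightarrow> c \<in> {..N} \<rightarrow> P 3))"
proof -
  have pr: "primeideal (P 0) R" "primeideal (P 1) R" "primeideal (P 2) R" "primeideal (P 3) R"
    using P(1) by simp_all
  have lt: "P 0 \<subset> P 1" "P 1 \<subset> P 2" "P 2 \<subset> P 3"
    using P(2)[of 0] P(2)[of 1] P(2)[of 2] by (simp_all add: numeral_2_eq_2 numeral_3_eq_3)
  interpret M: primeideal "P 3" R by (rule pr)
  obtain J where J: "saturated_ideal R (P 3) J" "J \<subset> P 3"
    "\<And>a b. a \<in> P 3 \<Longrightarrow> b \<in> P 3 \<Longrightarrow> a \<otimes> b \<in> J"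
    using ex_saturated_ideal_square_subset[OF pr(4,3) lt(3)] by blast
  interpret J: ideal J R using J by (intro saturated_idealD)
  obtain x where x: "x \<in> P 3" "x \<notin> J" using J by blast
  have xR: "x \<in> carrier R" using x by (simp add: M.Icarr)
  \<comment> \<open>If \<open>P 1\<close> misses \<open>x\<close>, the principal ideal theorem is
    used twice. It first replaces \<open>P 2\<close> by a prime \<open>Q2\<close> containing
    \<open>x\<close>, which is strictly above \<open>P 1\<close> because \<open>x\<close> is outside
    \<open>P 1\<close>. Applied to \<open>P 0 \<subset> P 1 \<subset> Q2\<close>, it then gives a
    prime containing \<open>x\<close> strictly inside \<open>Q2\<close>.\<close>
  obtain P0 P1 where P01: "primeideal P0 R" "primeideal P1 R" "x \<in> P0" "P0 \<subset> P1" "P1 \<subset> P 3"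
  proof (cases "x \<in> P 1")
    case True
    then show ?thesis using that pr lt by blast
  next
    case False
    obtain Q2 where Q2: "primeideal Q2 R" "P 1 \<subseteq> Q2" "x \<in> Q2" "Q2 \<subset> P 3"
      using ex_prime_between[OF pr(2,3,4) lt(2,3) x(1)] by blast
    then have lt': "P 1 \<subset> Q2" using False by blast
    obtain Q1 where "primeideal Q1 R" "x \<in> Q1" "Q1 \<subset> Q2"
      by (rule ex_prime_between[OF pr(1,2) Q2(1) lt(1) lt' Q2(3)])
    then show ?thesis using that Q2 by blast
  qed
  obtain Q f where Q: "saturated_ideal R P1 Q" "P0 \<subseteq> Q" and fP: "f \<in> {..<N} \<rightarrow> P 3"
    and indep: "\<And>c. c \<in> {..<N} \<rightarrow> carrier R \<Longrightarrow> (\<Oplus>k\<in>{..<N}. c k \<otimes> f k) \<in> Q \<Longrightarrow> c \<in> {..<N} \<rightarrow> P 3"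
    using ex_independent_family[OF P01(1,2) pr(4) P01(4,5), of N] by blast
  interpret Q: ideal Q R using Q by (intro saturated_idealD)
  define g where "g k = (if k < N then f k else x)" for k
  have fR: "f \<in> {..<N} \<rightarrow> carrier R" using fP M.Icarr by blast
  show ?thesis
  proof (intro exI[of _ J] conjI bexI[of _ g] ballI impI)
    show "g \<in> {..N} \<rightarrow> carrier R" using fR xR by (auto simp: g_def)
    show "g N \<notin> J" using x by (simp add: g_def)
    fix c assume c: "c \<in> {..N} \<rightarrow> carrier R" and rel: "(\<Oplus>k\<in>{..N}. c k \<otimes> g k) = \<zero>"
    have cR: "c \<in> {..<N} \<rightarrow> carrier R" "c N \<in> carrier R" using c by auto
    define w where "w = (\<Oplus>k\<in>{..<N}. c k \<otimes> f k)"
    have wR: "w \<in> carrier R" unfolding w_def using cR fR by (intro finsum_closed) auto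
    have "(\<Oplus>k\<in>{..<N}. c k \<otimes> g k) = w"
      unfolding w_def using cR fR by (intro finsum_cong') (auto simp: g_def Pi_iff)
    moreover have "(\<Oplus>k\<in>insert N {..<N}. c k \<otimes> g k) = c N \<otimes> g N \<oplus> (\<Oplus>k\<in>{..<N}. c k \<otimes> g k)"
      by (rule finsum_insert) (use cR fR xR in \<open>auto simp: g_def Pi_iff\<close>)
    ultimately have rel: "c N \<otimes> x \<oplus> w = \<zero>"
      using rel by (simp add: g_def flip: lessThan_Suc_atMost add: lessThan_Suc)
    have w: "w = (\<ominus> c N) \<otimes> x"
    proof -
      have "w = (c N \<otimes> x \<oplus> w) \<oplus> (\<ominus> c N) \<otimes> x" using cR xR wR by algebra
      then show ?thesis unfolding rel using cR xR by simp
    qed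
    have "w \<in> Q" unfolding w using P01(3) Q cR Q.I_l_closed by blast
    then have cM: "c \<in> {..<N} \<rightarrow> P 3" using indep[OF cR(1)] by (simp add: w_def)
    \<comment> \<open>Coefficients and family members both lie in \<open>P 3\<close>, and
      \<open>J\<close> contains all products of two elements of \<open>P 3\<close>.\<close>
    have "w \<in> J" unfolding w_def
    proof (rule J.finsum_mem)
      show "c k \<otimes> f k \<in> J" if "k \<in> {..<N}" for k using that cM fP J(3) by blast
    qed
    have "c N \<in> P 3"
    proof (rule ccontr)
      assume "c N \<notin> P 3"
      have "c N \<otimes> x \<in> J"
        by (rule ideal_add_cancel[OF J.is_ideal m_closed[OF cR(2) xR] \<open>w \<in> J\<close>]) (simp add: rel)
      then show False using saturated_idealD(2)[OF J(1) xR cR(2) \<open>c N \<notin> P 3\<close>] x(2) by simp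
    qed
    then show "c \<in> {..N} \<rightarrow> P 3" using cM by (auto simp flip: lessThan_Suc_atMost simp: lessThan_Suc)
  qed (rule J; assumption)+
qed

end
section \<open>Commutators of matrices\<close>

lemma (in ring) finsum_Times:
  assumes "finite A" "finite B" "\<And>i j. i \<in> A \<Longrightarrow> j \<in> B \<Longrightarrow> f (i, j) \<in> carrier R"
  shows "(\<Oplus>p\<in>A \<times> B. f p) = (\<Oplus>i\<in>A. \<Oplus>j\<in>B. f (i, j))"
  using assms(1,3)
proof (induction A rule: finite_induct)
  case empty
  then show ?case by simp
next
  case (insert a A)
  have "(\<Oplus>p\<in>insert a A \<times> B. f p) = (\<Oplus>p\<in>(Pair a ` B) \<union> A \<times> B. f p)"
    by (rule arg_cong[of _ _ "finsum R f"]) auto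
  also have "\<dots> = (\<Oplus>p\<in>Pair a ` B. f p) \<oplus> (\<Oplus>p\<in>A \<times> B. f p)"
    using insert assms(2) by (intro finsum_Un_disjoint) auto
  also have "(\<Oplus>p\<in>Pair a ` B. f p) = (\<Oplus>j\<in>B. f (a, j))"
    using insert by (intro finsum_reindex) (auto simp: inj_on_def)
  also have "(\<Oplus>p\<in>A \<times> B. f p) = (\<Oplus>i\<in>A. \<Oplus>j\<in>B. f (i, j))"
    using insert by auto
  also have "(\<Oplus>j\<in>B. f (a, j)) \<oplus> (\<Oplus>i\<in>A. \<Oplus>j\<in>B. f (i, j)) = (\<Oplus>i\<in>insert a A. \<Oplus>j\<in>B. f (i, j))"
    using insert by (intro finsum_insert[symmetric]) (auto intro!: finsum_closed)
  finally show ?case .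
qed

lemma (in ring) finsum_minus:
  assumes "f \<in> A \<rightarrow> carrier R" "g \<in> A \<rightarrow> carrier R"
  shows "(\<Oplus>i\<in>A. f i \<ominus> g i) = (\<Oplus>i\<in>A. f i) \<ominus> (\<Oplus>i\<in>A. g i)"
  using assms
proof (induction A rule: infinite_finite_induct)
  case (insert a A)
  then have *: "f a \<in> carrier R" "g a \<in> carrier R" "f \<in> A \<rightarrow> carrier R" "g \<in> A \<rightarrow> carrier R"
    by auto
  have "(\<lambda>i. f i \<ominus> g i) \<in> A \<rightarrow> carrier R" using * by auto
  moreover have "(\<Oplus>i\<in>A. f i) \<in> carrier R" "(\<Oplus>i\<in>A. g i) \<in> carrier R"
    using * by (auto intro!: finsum_closed)
  ultimately show ?case
    using insert * by (simp add: a_minus_def minus_add a_ac)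
qed (simp_all add: a_minus_def)

text \<open>Coefficient functions replace matrices here, so that scalar matrices can be subtracted
  entrywise; only values at indices below \<open>n\<close> enter.\<close>

definition comm_entry ::
  "('a, 'b) ring_scheme \<Rightarrow> nat \<Rightarrow> (nat \<Rightarrow> nat \<Rightarrow> 'a) \<Rightarrow> (nat \<Rightarrow> nat \<Rightarrow> 'a) \<Rightarrow> nat \<Rightarrow> nat \<Rightarrow> 'a" where
  "comm_entry R n a b i j =
    (\<Oplus>\<^bsub>R\<^esub>k\<in>{..<n}. a i k \<otimes>\<^bsub>R\<^esub> b k j) \<ominus>\<^bsub>R\<^esub> (\<Oplus>\<^bsub>R\<^esub>k\<in>{..<n}. b i k \<otimes>\<^bsub>R\<^esub> a k j)"

definition sub_scalar :: "('a, 'b) ring_scheme \<Rightarrow> (nat \<Rightarrow> nat \<Rightarrow> 'a) \<Rightarrow> 'a \<Rightarrow> nat \<Rightarrow> nat \<Rightarrow> 'a" where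
  "sub_scalar R a x i j = a i j \<ominus>\<^bsub>R\<^esub> x \<otimes>\<^bsub>R\<^esub> (if i = j then \<one>\<^bsub>R\<^esub> else \<zero>\<^bsub>R\<^esub>)"

section \<open>Trace relations of commutators\<close>

context cring
begin

lemma comm_entry_swap:
  assumes "a \<in> {..<n} \<rightarrow> {..<n} \<rightarrow> carrier R" "b \<in> {..<n} \<rightarrow> {..<n} \<rightarrow> carrier R" "i < n" "j < n"
  shows "comm_entry R n b a i j = \<ominus> comm_entry R n a b i j"
proof -
  have "(\<Oplus>k\<in>{..<n}. a i k \<otimes> b k j) \<in> carrier R" "(\<Oplus>k\<in>{..<n}. b i k \<otimes> a k j) \<in> carrier R"
    using assms by (auto simp: Pi_iff intro!: finsum_closed)
  moreover have "v \<ominus> u = \<ominus> (u \<ominus> v)" if "u \<in> carrier R" "v \<in> carrier R" for u v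
    using that by algebra
  ultimately show ?thesis unfolding comm_entry_def by blast
qed

text \<open>Scalar matrices are central: both products lose the same term
  \<open>x \<otimes> b i j\<close>.\<close>

lemma comm_entry_sub_scalar:
  assumes a: "a \<in> {..<n} \<rightarrow> {..<n} \<rightarrow> carrier R" and b: "b \<in> {..<n} \<rightarrow> {..<n} \<rightarrow> carrier R"
    and ij: "i < n" "j < n" and x: "x \<in> carrier R"
  shows "comm_entry R n (sub_scalar R a x) b i j = comm_entry R n a b i j"
proof -
  define d where "d i k = (if i = k then \<one> else \<zero>)" for i k :: nat
  have d [simp]: "d i k \<in> carrier R" for i k by (simp add: d_def)
  have car: "a k l \<in> carrier R" "b k l \<in> carrier R" if "k < n" "l < n" for k l
    using a b that by (auto simp: Pi_iff)
  have "(\<Oplus>k\<in>{..<n}. sub_scalar R a x i k \<otimes> b k j)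
      = (\<Oplus>k\<in>{..<n}. a i k \<otimes> b k j \<ominus> x \<otimes> (d i k \<otimes> b k j))"
  proof (rule finsum_cong')
    fix k assume k: "k \<in> {..<n}"
    have "(u \<ominus> x \<otimes> v) \<otimes> w = u \<otimes> w \<ominus> x \<otimes> (v \<otimes> w)"
      if "u \<in> carrier R" "v \<in> carrier R" "w \<in> carrier R" for u v w
      using that x by algebra
    then have "(a i k \<ominus> x \<otimes> d i k) \<otimes> b k j = a i k \<otimes> b k j \<ominus> x \<otimes> (d i k \<otimes> b k j)"
      using car k ij by simp
    then show "sub_scalar R a x i k \<otimes> b k j = a i k \<otimes> b k j \<ominus> x \<otimes> (d i k \<otimes> b k j)"
      by (simp add: sub_scalar_def d_def)
  qed (use car ij x in auto)
  also have "\<dots> = (\<Oplus>k\<in>{..<n}. a i k \<otimes> b k j) \<ominus> (\<Oplus>k\<in>{..<n}. x \<otimes> (d i k \<otimes> b k j))"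
    using car ij x by (intro finsum_minus) auto
  also have "(\<Oplus>k\<in>{..<n}. x \<otimes> (d i k \<otimes> b k j)) = x \<otimes> (\<Oplus>k\<in>{..<n}. d i k \<otimes> b k j)"
    using car ij x by (intro finsum_rdistr[symmetric]) auto
  also have "(\<Oplus>k\<in>{..<n}. d i k \<otimes> b k j) = b i j"
    unfolding d_def using finsum_delta_left[of i n "\<lambda>k. b k j"] car ij by simp
  finally have 1: "(\<Oplus>k\<in>{..<n}. sub_scalar R a x i k \<otimes> b k j)
      = (\<Oplus>k\<in>{..<n}. a i k \<otimes> b k j) \<ominus> x \<otimes> b i j" .
  have "(\<Oplus>k\<in>{..<n}. b i k \<otimes> sub_scalar R a x k j)
      = (\<Oplus>k\<in>{..<n}. b i k \<otimes> a k j \<ominus> x \<otimes> (b i k \<otimes> d k j))"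
  proof (rule finsum_cong')
    fix k assume k: "k \<in> {..<n}"
    have "w \<otimes> (u \<ominus> x \<otimes> v) = w \<otimes> u \<ominus> x \<otimes> (w \<otimes> v)"
      if "u \<in> carrier R" "v \<in> carrier R" "w \<in> carrier R" for u v w
      using that x by algebra
    then have "b i k \<otimes> (a k j \<ominus> x \<otimes> d k j) = b i k \<otimes> a k j \<ominus> x \<otimes> (b i k \<otimes> d k j)"
      using car k ij by simp
    then show "b i k \<otimes> sub_scalar R a x k j = b i k \<otimes> a k j \<ominus> x \<otimes> (b i k \<otimes> d k j)"
      by (simp add: sub_scalar_def d_def)
  qed (use car ij x in auto)
  also have "\<dots> = (\<Oplus>k\<in>{..<n}. b i k \<otimes> a k j) \<ominus> (\<Oplus>k\<in>{..<n}. x \<otimes> (b i k \<otimes> d k j))"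
    using car ij x by (intro finsum_minus) auto
  also have "(\<Oplus>k\<in>{..<n}. x \<otimes> (b i k \<otimes> d k j)) = x \<otimes> (\<Oplus>k\<in>{..<n}. b i k \<otimes> d k j)"
    using car ij x by (intro finsum_rdistr[symmetric]) auto
  also have "(\<Oplus>k\<in>{..<n}. b i k \<otimes> d k j) = b i j"
    unfolding d_def using finsum_delta_right[of j n "\<lambda>k. b i k"] car ij by simp
  finally have 2: "(\<Oplus>k\<in>{..<n}. b i k \<otimes> sub_scalar R a x k j)
      = (\<Oplus>k\<in>{..<n}. b i k \<otimes> a k j) \<ominus> x \<otimes> b i j" .
  have "(\<Oplus>k\<in>{..<n}. a i k \<otimes> b k j) \<in> carrier R" "(\<Oplus>k\<in>{..<n}. b i k \<otimes> a k j) \<in> carrier R"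
    using car ij by (auto intro!: finsum_closed)
  moreover have "(u \<ominus> w) \<ominus> (v \<ominus> w) = u \<ominus> v" if "u \<in> carrier R" "v \<in> carrier R" "w \<in> carrier R" for u v w
    using that by algebra
  ultimately show ?thesis
    unfolding comm_entry_def 1 2 using x car(2)[OF ij] by simp
qed

lemma comm_entry_sub_scalars:
  assumes a: "a \<in> {..<n} \<rightarrow> {..<n} \<rightarrow> carrier R" and b: "b \<in> {..<n} \<rightarrow> {..<n} \<rightarrow> carrier R"
    and ij: "i < n" "j < n" and x: "x \<in> carrier R" and y: "y \<in> carrier R"
  shows "comm_entry R n (sub_scalar R a x) (sub_scalar R b y) i j = comm_entry R n a b i j"
proof -
  have a': "sub_scalar R a x \<in> {..<n} \<rightarrow> {..<n} \<rightarrow> carrier R"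
    using a x by (auto simp: sub_scalar_def Pi_iff)
  have "comm_entry R n (sub_scalar R a x) (sub_scalar R b y) i j
      = \<ominus> comm_entry R n (sub_scalar R b y) (sub_scalar R a x) i j"
    using a' b y ij by (intro comm_entry_swap) (auto simp: sub_scalar_def Pi_iff)
  also have "\<dots> = \<ominus> comm_entry R n b (sub_scalar R a x) i j"
    by (simp add: comm_entry_sub_scalar[OF b a' ij y])
  also have "\<dots> = comm_entry R n (sub_scalar R a x) b i j"
    by (rule comm_entry_swap[OF b a' ij, symmetric])
  also have "\<dots> = comm_entry R n a b i j"
    by (rule comm_entry_sub_scalar[OF a b ij x])
  finally show ?thesis .
qed

text \<open>Cyclicity of the trace: \<open>tr (a a b) = tr (a b a)\<close>.\<close>

lemma trace_mult_comm_entry: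
  assumes a: "a \<in> {..<n} \<rightarrow> {..<n} \<rightarrow> carrier R" and b: "b \<in> {..<n} \<rightarrow> {..<n} \<rightarrow> carrier R"
  shows "(\<Oplus>i\<in>{..<n}. \<Oplus>j\<in>{..<n}. a j i \<otimes> comm_entry R n a b i j) = \<zero>"
proof -
  have car: "a k l \<in> carrier R" "b k l \<in> carrier R" if "k < n" "l < n" for k l
    using a b that by (auto simp: Pi_iff)
  \<comment> \<open>One summand serves both products: by commutativity
    \<open>a j i \<otimes> (b i k \<otimes> a k j)\<close> equals \<open>T j k i\<close>. The triple
    sums thus differ by a cyclic renaming, which two exchanges of summation realise.\<close>
  define T where "T i j k = a j i \<otimes> (a i k \<otimes> b k j)" for i j k
  have T: "T i j k \<in> carrier R" if "i < n" "j < n" "k < n" for i j k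
    using car that by (simp add: T_def)
  have T1: "(\<Oplus>k\<in>{..<n}. T i j k) \<in> carrier R" "(\<Oplus>k\<in>{..<n}. T j k i) \<in> carrier R"
    "(\<Oplus>i\<in>{..<n}. T j k i) \<in> carrier R"
    if "i < n" "j < n" "k < n" for i j k
    using that T by (auto intro!: finsum_closed)
  have "a j i \<otimes> comm_entry R n a b i j = (\<Oplus>k\<in>{..<n}. T i j k) \<ominus> (\<Oplus>k\<in>{..<n}. T j k i)"
    if ij: "i < n" "j < n" for i j
  proof -
    have "(\<Oplus>k\<in>{..<n}. a i k \<otimes> b k j) \<in> carrier R" "(\<Oplus>k\<in>{..<n}. b i k \<otimes> a k j) \<in> carrier R"
      using car ij by (auto intro!: finsum_closed)
    moreover have "t \<otimes> (u \<ominus> v) = t \<otimes> u \<ominus> t \<otimes> v" if "t \<in> carrier R" "u \<in> carrier R" "v \<in> carrier R" for t u v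
      using that by algebra
    ultimately have "a j i \<otimes> comm_entry R n a b i j = a j i \<otimes> (\<Oplus>k\<in>{..<n}. a i k \<otimes> b k j)
        \<ominus> a j i \<otimes> (\<Oplus>k\<in>{..<n}. b i k \<otimes> a k j)"
      unfolding comm_entry_def using car(1)[OF ij(2,1)] by blast
    also have "a j i \<otimes> (\<Oplus>k\<in>{..<n}. a i k \<otimes> b k j) = (\<Oplus>k\<in>{..<n}. T i j k)"
      unfolding T_def using car ij by (intro finsum_rdistr) auto
    also have "a j i \<otimes> (\<Oplus>k\<in>{..<n}. b i k \<otimes> a k j) = (\<Oplus>k\<in>{..<n}. a j i \<otimes> (b i k \<otimes> a k j))"
      using car ij by (intro finsum_rdistr) auto
    also have "\<dots> = (\<Oplus>k\<in>{..<n}. T j k i)"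
      using car ij by (intro finsum_cong') (auto simp: T_def m_ac)
    finally show ?thesis .
  qed
  then have "(\<Oplus>i\<in>{..<n}. \<Oplus>j\<in>{..<n}. a j i \<otimes> comm_entry R n a b i j)
      = (\<Oplus>i\<in>{..<n}. \<Oplus>j\<in>{..<n}. (\<Oplus>k\<in>{..<n}. T i j k) \<ominus> (\<Oplus>k\<in>{..<n}. T j k i))"
    using T1 by (intro finsum_cong' refl) (auto intro!: finsum_closed)
  also have "\<dots> = (\<Oplus>i\<in>{..<n}. (\<Oplus>j\<in>{..<n}. \<Oplus>k\<in>{..<n}. T i j k) \<ominus> (\<Oplus>j\<in>{..<n}. \<Oplus>k\<in>{..<n}. T j k i))"
    using T1 by (intro finsum_cong' refl finsum_minus) (auto intro!: finsum_closed)
  also have "\<dots> = (\<Oplus>i\<in>{..<n}. \<Oplus>j\<in>{..<n}. \<Oplus>k\<in>{..<n}. T i j k)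
      \<ominus> (\<Oplus>i\<in>{..<n}. \<Oplus>j\<in>{..<n}. \<Oplus>k\<in>{..<n}. T j k i)"
    using T1 by (intro finsum_minus) (auto intro!: finsum_closed)
  also have "(\<Oplus>i\<in>{..<n}. \<Oplus>j\<in>{..<n}. \<Oplus>k\<in>{..<n}. T j k i)
      = (\<Oplus>j\<in>{..<n}. \<Oplus>i\<in>{..<n}. \<Oplus>k\<in>{..<n}. T j k i)"
    using T1 by (intro finsum_finsum_swap) auto
  also have "\<dots> = (\<Oplus>j\<in>{..<n}. \<Oplus>k\<in>{..<n}. \<Oplus>i\<in>{..<n}. T j k i)"
    using T T1 by (intro finsum_cong' refl finsum_finsum_swap) (auto intro!: finsum_closed)
  finally show ?thesis
    using T1 by (simp add: r_right_minus_eq Pi_iff finsum_closed)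
qed

lemma matrix_comm_entry:
  assumes A: "A \<in> carrier (matrix_ring R n)" and B: "B \<in> carrier (matrix_ring R n)"
    and ij: "i < n" "j < n"
  shows "(A \<otimes>\<^bsub>matrix_ring R n\<^esub> B \<ominus>\<^bsub>matrix_ring R n\<^esub> B \<otimes>\<^bsub>matrix_ring R n\<^esub> A) $$ (i, j)
    = comm_entry R n (\<lambda>i j. A $$ (i, j)) (\<lambda>i j. B $$ (i, j)) i j"
proof -
  interpret M: ring "matrix_ring R n" by (rule ring_matrix_ring)
  let ?C = "A \<otimes>\<^bsub>matrix_ring R n\<^esub> B \<ominus>\<^bsub>matrix_ring R n\<^esub> B \<otimes>\<^bsub>matrix_ring R n\<^esub> A"
  have C: "?C \<in> carrier (matrix_ring R n)" using A B by simp
  \<comment> \<open>Subtraction in \<open>matrix_ring\<close> goes through an abstract additive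
    inverse without an entry formula. The entries of \<open>?C\<close> are therefore read off from
    the sum \<open>?C + B A = A B\<close>.\<close>
  have "?C \<oplus>\<^bsub>matrix_ring R n\<^esub> B \<otimes>\<^bsub>matrix_ring R n\<^esub> A = A \<otimes>\<^bsub>matrix_ring R n\<^esub> B"
    using A B by (simp add: a_minus_def M.a_assoc M.l_neg)
  then have "(?C \<oplus>\<^bsub>matrix_ring R n\<^esub> B \<otimes>\<^bsub>matrix_ring R n\<^esub> A) $$ (i, j)
      = (A \<otimes>\<^bsub>matrix_ring R n\<^esub> B) $$ (i, j)" by simp
  then have "?C $$ (i, j) \<oplus> (\<Oplus>k\<in>{..<n}. B $$ (i, k) \<otimes> A $$ (k, j))
      = (\<Oplus>k\<in>{..<n}. A $$ (i, k) \<otimes> B $$ (k, j))"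
    using ij by (simp add: matrix_ring_def)
  moreover have "?C $$ (i, j) \<in> carrier R" using C ij by (simp add: matrix_ring_def)
  moreover have "(\<Oplus>k\<in>{..<n}. B $$ (i, k) \<otimes> A $$ (k, j)) \<in> carrier R"
    using A B ij by (auto simp: matrix_ring_def intro!: finsum_closed)
  moreover have "u = w \<ominus> v" if "u \<oplus> v = w" "u \<in> carrier R" "v \<in> carrier R" for u v w
    unfolding that(1)[symmetric] using that(2,3) by algebra
  ultimately show ?thesis unfolding comm_entry_def by blast
qed

text \<open>The trace relations of a presumed commutator are linear relations among the entries at
  \<open>I\<close>, with entries of the two factors as coefficients. Minimality puts these
  coefficients into \<open>M\<close>, so each entry of the commutator is a sum of products from
  \<open>M\<close> and lies in \<open>K\<close>, against \<open>f p \<notin> K\<close>.\<close>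

lemma ex_trace_zero_not_commutator:
  fixes n :: nat
  defines "I \<equiv> {..<n} \<times> {..<n} - {(n - 1, n - 1)}"
  assumes n: "n > 0" and M: "ideal M R" and K: "ideal K R"
    and MK: "\<And>a b. a \<in> M \<Longrightarrow> b \<in> M \<Longrightarrow> a \<otimes> b \<in> K"
    and f: "f \<in> I \<rightarrow> carrier R" and p: "p \<in> I" "f p \<notin> K"
    and minimal: "\<And>c. c \<in> I \<rightarrow> carrier R \<Longrightarrow> (\<Oplus>p\<in>I. c p \<otimes> f p) = \<zero> \<Longrightarrow> c \<in> I \<rightarrow> M"
  shows "\<exists>C\<in>carrier (matrix_ring R n). matrix_trace R n C = \<zero> \<and> \<not> is_commutator (matrix_ring R n) C"
proof -
  obtain m where m: "n = Suc m" using n by (cases n) auto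
  interpret M: ideal M R by fact
  interpret K: ideal K R by fact
  have I_eq: "{..<n} \<times> {..<n} = insert (m, m) I" "(m, m) \<notin> I" "finite I"
    using m by (auto simp: I_def)
  define C where "C = mat n n (\<lambda>(i, j). if (i, j) = (m, m) then \<ominus> (\<Oplus>i\<in>{..<m}. f (i, i)) else f (i, j))"
  have fd: "(\<lambda>i. f (i, i)) \<in> {..<m} \<rightarrow> carrier R" using f by (auto simp: I_def m)
  have CI: "C $$ p = f p" if "p \<in> I" for p using that by (auto simp: C_def I_def m split: if_splits)
  have Ccar: "C \<in> carrier (matrix_ring R n)"
    using f fd by (auto simp: matrix_ring_def C_def I_def m intro!: finsum_closed)
  have "matrix_trace R n C = C $$ (m, m) \<oplus> (\<Oplus>i\<in>{..<m}. C $$ (i, i))"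
    unfolding matrix_trace_def m lessThan_Suc using Ccar
    by (intro finsum_insert) (auto simp: matrix_ring_def m)
  also have "(\<Oplus>i\<in>{..<m}. C $$ (i, i)) = (\<Oplus>i\<in>{..<m}. f (i, i))"
    using fd by (intro finsum_cong') (auto simp: I_def m intro!: CI)
  also have "C $$ (m, m) = \<ominus> (\<Oplus>i\<in>{..<m}. f (i, i))" by (simp add: C_def m)
  finally have tr: "matrix_trace R n C = \<zero>" using fd by (simp add: l_neg finsum_closed)
  have "\<not> is_commutator (matrix_ring R n) C"
  proof
    assume "is_commutator (matrix_ring R n) C"
    then obtain A B where A: "A \<in> carrier (matrix_ring R n)" and B: "B \<in> carrier (matrix_ring R n)"
      and CAB: "C = A \<otimes>\<^bsub>matrix_ring R n\<^esub> B \<ominus>\<^bsub>matrix_ring R n\<^esub> B \<otimes>\<^bsub>matrix_ring R n\<^esub> A"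
      unfolding is_commutator_def by blast
    have car: "A $$ (i, j) \<in> carrier R" "B $$ (i, j) \<in> carrier R" if "i < n" "j < n" for i j
      using A B that by (auto simp: matrix_ring_def)
    have mn: "m < n" by (simp add: m)
    \<comment> \<open>Normalised so that the entry at \<open>(m, m)\<close>, the last position, is
      zero: \<open>C $$ (m, m)\<close> is not among the generators and must not occur in the
      relations.\<close>
    define a where "a = sub_scalar R (\<lambda>i j. A $$ (i, j)) (A $$ (m, m))"
    define b where "b = sub_scalar R (\<lambda>i j. B $$ (i, j)) (B $$ (m, m))"
    have a: "a \<in> {..<n} \<rightarrow> {..<n} \<rightarrow> carrier R" and b: "b \<in> {..<n} \<rightarrow> {..<n} \<rightarrow> carrier R"
      using car mn by (auto simp: a_def b_def sub_scalar_def)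
    have amm: "a m m = \<zero>" and bmm: "b m m = \<zero>"
      using car[OF mn mn] by (simp_all add: a_def b_def sub_scalar_def a_minus_def r_neg)
    have Cab: "C $$ (i, j) = comm_entry R n a b i j" if ij: "i < n" "j < n" for i j
      unfolding CAB matrix_comm_entry[OF A B ij] a_def b_def
      using car ij mn by (intro comm_entry_sub_scalars[symmetric]) auto
    have mem: "u j i \<in> M" if u: "u \<in> {..<n} \<rightarrow> {..<n} \<rightarrow> carrier R" and umm: "u m m = \<zero>"
      and eq: "(\<Oplus>i\<in>{..<n}. \<Oplus>j\<in>{..<n}. u j i \<otimes> C $$ (i, j)) = \<zero>" and ij: "i < n" "j < n" for u i j
    proof (cases "(i, j) = (m, m)")
      case True
      then show ?thesis using umm by simp
    next
      case False
      have uc: "u j i \<in> carrier R" if "i < n" "j < n" for i j using u that by (auto simp: Pi_iff)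
      have cc: "C $$ (i, j) \<in> carrier R" if "i < n" "j < n" for i j
        using Ccar that by (auto simp: matrix_ring_def)
      let ?g = "\<lambda>p. u (snd p) (fst p)"
      have gI: "?g \<in> I \<rightarrow> carrier R" using uc by (auto simp: I_def)
      have "(\<Oplus>i\<in>{..<n}. \<Oplus>j\<in>{..<n}. u j i \<otimes> C $$ (i, j)) = (\<Oplus>p\<in>{..<n} \<times> {..<n}. ?g p \<otimes> C $$ p)"
        using uc cc by (subst finsum_Times) auto
      also have "\<dots> = ?g (m, m) \<otimes> C $$ (m, m) \<oplus> (\<Oplus>p\<in>I. ?g p \<otimes> C $$ p)"
        unfolding I_eq(1) using I_eq uc cc mn by (intro finsum_insert) (auto simp: I_def)
      also have "(\<Oplus>p\<in>I. ?g p \<otimes> C $$ p) = (\<Oplus>p\<in>I. ?g p \<otimes> f p)"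
        using CI gI f by (intro finsum_cong') (auto simp: Pi_iff)
      also have "?g (m, m) \<otimes> C $$ (m, m) = \<zero>" using umm cc[OF mn mn] by simp
      finally have "\<zero> \<oplus> (\<Oplus>p\<in>I. ?g p \<otimes> f p) = \<zero>" using eq by simp
      moreover have "(\<Oplus>p\<in>I. ?g p \<otimes> f p) \<in> carrier R"
        using gI f by (auto simp: Pi_iff intro!: finsum_closed)
      ultimately have "?g \<in> I \<rightarrow> M" using minimal[OF gI] by simp
      moreover have "(i, j) \<in> I" using False ij by (auto simp: I_def m)
      ultimately show ?thesis by (auto simp: Pi_iff)
    qed
    have aM: "a j i \<in> M" if ij: "i < n" "j < n" for i j
    proof (rule mem[OF a amm _ ij])
      have "(\<Oplus>i\<in>{..<n}. \<Oplus>j\<in>{..<n}. a j i \<otimes> C $$ (i, j))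
          = (\<Oplus>i\<in>{..<n}. \<Oplus>j\<in>{..<n}. a j i \<otimes> comm_entry R n a b i j)"
        using a Cab Ccar by (intro finsum_cong' refl)
          (auto simp: Pi_iff matrix_ring_def simp flip: Cab intro!: finsum_closed)
      then show "(\<Oplus>i\<in>{..<n}. \<Oplus>j\<in>{..<n}. a j i \<otimes> C $$ (i, j)) = \<zero>"
        using trace_mult_comm_entry[OF a b] by simp
    qed
    have bM: "b j i \<in> M" if ij: "i < n" "j < n" for i j
    proof (rule mem[OF b bmm _ ij])
      have ce: "comm_entry R n b a i j \<in> carrier R" if "i < n" "j < n" for i j
        using a b that unfolding comm_entry_def by (auto simp: Pi_iff intro!: finsum_closed)
      \<comment> \<open>The trace lemma multiplies by the first factor, so \<open>b\<close> needs
        the commutator in the opposite order, at the cost of a sign.\<close>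
      have "(\<Oplus>i\<in>{..<n}. \<Oplus>j\<in>{..<n}. b j i \<otimes> C $$ (i, j))
          = (\<Oplus>i\<in>{..<n}. \<Oplus>j\<in>{..<n}. \<ominus> \<one> \<otimes> (b j i \<otimes> comm_entry R n b a i j))"
      proof (intro finsum_cong' refl)
        fix i j assume "i \<in> {..<n}" "j \<in> {..<n}"
        then have ij: "i < n" "j < n" by auto
        then have "b j i \<in> carrier R" using b by (auto simp: Pi_iff)
        then show "b j i \<otimes> C $$ (i, j) = \<ominus> \<one> \<otimes> (b j i \<otimes> comm_entry R n b a i j)"
          unfolding Cab[OF ij] comm_entry_swap[OF b a ij] using ce[OF ij] by (simp add: l_minus r_minus)
      qed (use b ce in \<open>auto simp: Pi_iff intro!: finsum_closed\<close>)
      also have "\<dots> = (\<Oplus>i\<in>{..<n}. \<ominus> \<one> \<otimes> (\<Oplus>j\<in>{..<n}. b j i \<otimes> comm_entry R n b a i j))"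
        using b ce by (intro finsum_cong' refl finsum_rdistr[symmetric])
          (auto simp: Pi_iff intro!: finsum_closed)
      also have "\<dots> = \<ominus> \<one> \<otimes> (\<Oplus>i\<in>{..<n}. \<Oplus>j\<in>{..<n}. b j i \<otimes> comm_entry R n b a i j)"
        using b ce by (intro finsum_rdistr[symmetric]) (auto simp: Pi_iff intro!: finsum_closed)
      finally show "(\<Oplus>i\<in>{..<n}. \<Oplus>j\<in>{..<n}. b j i \<otimes> C $$ (i, j)) = \<zero>"
        using trace_mult_comm_entry[OF b a] by simp
    qed
    obtain i j where ij: "p = (i, j)" "i < n" "j < n" using p by (auto simp: I_def)
    have "(\<Oplus>k\<in>{..<n}. a i k \<otimes> b k j) \<in> K" "(\<Oplus>k\<in>{..<n}. b i k \<otimes> a k j) \<in> K"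
      using ij aM bM by (auto intro!: K.finsum_mem MK)
    then have "comm_entry R n a b i j \<in> K"
      unfolding comm_entry_def a_minus_def by simp
    then show False using CI[OF p(1)] Cab p ij by simp
  qed
  then show ?thesis using Ccar tr by blast
qed

end

section \<open>Descent from the localisation\<close>

context mult_subset
begin

lemma ring_hom_cring_frac_class:
  "ring_hom_cring R (localization R S) (\<lambda>r. frac_class R S r \<one>)"
proof (intro ring_hom_cring.intro ring_hom_cring_axioms.intro is_cring cring_localization)
  show "(\<lambda>r. frac_class R S r \<one>) \<in> Ring.ring_hom R (localization R S)"
    by (rule ring_hom_memI) (simp_all add: mult_frac add_frac one_frac)
qed

lemma frac_class_not_in_prime:
  assumes "primeideal P (localization R S)" "s \<in> S"
  shows "frac_class R S s \<one> \<notin> P"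
proof
  interpret P: primeideal P "localization R S" by fact
  assume *: "frac_class R S s \<one> \<in> P"
  have "frac_class R S \<one> s \<otimes>\<^bsub>localization R S\<^esub> frac_class R S s \<one> = \<one>\<^bsub>localization R S\<^esub>"
    using assms(2) S_carrier by (simp add: mult_frac one_frac) (rule frac_class_eqI, simp_all)
  then have "\<one>\<^bsub>localization R S\<^esub> \<in> P" using P.I_l_closed[OF *, of "frac_class R S \<one> s"] assms by simp
  then show False using P.I_notcarr P.one_imp_carrier by blast
qed

text \<open>The generators in the localisation are replaced by numerators. This multiplies each by
  some \<open>h (s k)\<close>, which is a unit there, so neither independence nor the position
  outside \<open>J\<close> is lost. The matrix argument then runs in \<open>R\<close> with the
  preimages of \<open>P 3\<close> and \<open>J\<close>.\<close>

lemma ex_trace_zero_not_commutator_localization: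
  assumes noeth: "noetherian_ring (localization R S)"
    and P: "\<And>i. i \<le> 3 \<Longrightarrow> primeideal (P i) (localization R S)"
      "\<And>i. i < 3 \<Longrightarrow> P i \<subset> P (Suc i)"
    and n: "n \<ge> 2"
  shows "\<exists>C\<in>carrier (matrix_ring R n). matrix_trace R n C = \<zero> \<and> \<not> is_commutator (matrix_ring R n) C"
proof -
  define L where "L = localization R S"
  define h where "h r = frac_class R S r \<one>" for r
  interpret L: noetherian_cring L
    unfolding L_def by (intro noetherian_cring.intro noeth cring_localization)
  interpret h: ring_hom_cring R L h
    unfolding L_def h_def by (rule ring_hom_cring_frac_class)
  define I where "I = {..<n} \<times> {..<n} - {(n - 1, n - 1)}"
  have I: "finite I" by (simp add: I_def)
  \<comment> \<open>The family has \<open>N + 1\<close> members, so \<open>I\<close> must be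
    nonempty; \<open>n \<ge> 2\<close> provides a position other than the last.\<close>
  have "(0, 0) \<in> I" using n by (simp add: I_def)
  then have "card I \<noteq> 0" using I by auto
  then obtain N where N: "card I = Suc N" using not0_implies_Suc by blast
  obtain idx where "bij_betw idx I {0..<card I}"
    using ex_bij_betw_finite_nat[OF I] by blast
  then have idx: "bij_betw idx I {..N}"
    by (simp add: N atLeast0LessThan lessThan_Suc_atMost)
  then have idx_img: "idx ` I = {..N}" and idx_inj: "inj_on idx I"
    by (simp_all add: bij_betw_def)
  have pr: "primeideal (P 3) L" using P(1) by (simp add: L_def)
  interpret M: primeideal "P 3" L by (rule pr)
  have "\<exists>J. saturated_ideal L (P 3) J \<and> (\<forall>a\<in>P 3. \<forall>b\<in>P 3. a \<otimes>\<^bsub>L\<^esub> b \<in> J) \<and>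
    (\<exists>f\<in>{..N} \<rightarrow> carrier L. f N \<notin> J \<and> (\<forall>c\<in>{..N} \<rightarrow> carrier L.
      (\<Oplus>\<^bsub>L\<^esub>k\<in>{..N}. c k \<otimes>\<^bsub>L\<^esub> f k) = \<zero>\<^bsub>L\<^esub> \<longrightarrow> c \<in> {..N} \<rightarrow> P 3))"
    using P by (intro L.ex_minimal_generators) (simp_all add: L_def)
  then obtain J f where J: "saturated_ideal L (P 3) J"
    and J2: "\<And>a b. a \<in> P 3 \<Longrightarrow> b \<in> P 3 \<Longrightarrow> a \<otimes>\<^bsub>L\<^esub> b \<in> J"
    and f: "f \<in> {..N} \<rightarrow> carrier L" and fN: "f N \<notin> J"
    and indep: "\<And>c. c \<in> {..N} \<rightarrow> carrier L \<Longrightarrow> (\<Oplus>\<^bsub>L\<^esub>k\<in>{..N}. c k \<otimes>\<^bsub>L\<^esub> f k) = \<zero>\<^bsub>L\<^esub> \<Longrightarrow> c \<in> {..N} \<rightarrow> P 3"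
    by blast
  have "\<exists>a s. a \<in> carrier R \<and> s \<in> S \<and> h s \<otimes>\<^bsub>L\<^esub> f k = h a" if "k \<le> N" for k
  proof -
    have "f k \<in> carrier (localization R S)" using f that by (auto simp: L_def)
    then obtain a s where as: "a \<in> carrier R" "s \<in> S" "f k = frac_class R S a s"
      by (rule frac_cases)
    have "h s \<otimes>\<^bsub>L\<^esub> f k = h a"
      unfolding h_def L_def as(3) using as(1,2) S_carrier
      by (simp add: mult_frac) (rule frac_class_eqI, simp_all add: m_comm)
    then show ?thesis using as by blast
  qed
  then obtain a s where as: "\<And>k. k \<le> N \<Longrightarrow> a k \<in> carrier R" "\<And>k. k \<le> N \<Longrightarrow> s k \<in> S"
    "\<And>k. k \<le> N \<Longrightarrow> h (s k) \<otimes>\<^bsub>L\<^esub> f k = h (a k)" by metis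
  have hs: "h (s k) \<notin> P 3" if "k \<le> N" for k
    using frac_class_not_in_prime[OF pr[unfolded L_def] as(2)[OF that]] by (simp add: h_def)
  have sR: "s k \<in> carrier R" if "k \<le> N" for k using as(2)[OF that] S_carrier by blast
  have fL: "f k \<in> carrier L" if "k \<le> N" for k using f that by auto
  have idx_le: "idx p \<le> N" if "p \<in> I" for p using idx_img that by auto
  \<comment> \<open>The matrix position that receives the generator outside
    \<open>J\<close>.\<close>
  obtain p0 where p0: "p0 \<in> I" "idx p0 = N" using idx_img by (metis atMost_iff imageE order_refl)
  show ?thesis
  proof (rule ex_trace_zero_not_commutator[where n = n and f = "\<lambda>p. a (idx p)" and p = p0
        and M = "{r \<in> carrier R. h r \<in> P 3}" and K = "{r \<in> carrier R. h r \<in> J}", folded I_def])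
    show "n > 0" using n by simp
    show "ideal {r \<in> carrier R. h r \<in> P 3} R" by (rule h.ring.ideal_vimage[OF M.is_ideal])
    show "ideal {r \<in> carrier R. h r \<in> J} R" by (rule h.ring.ideal_vimage[OF saturated_idealD(1)[OF J]])
    show "u \<otimes> v \<in> {r \<in> carrier R. h r \<in> J}"
      if "u \<in> {r \<in> carrier R. h r \<in> P 3}" "v \<in> {r \<in> carrier R. h r \<in> P 3}" for u v
      using that J2 by simp
    show "(\<lambda>p. a (idx p)) \<in> I \<rightarrow> carrier R" using as(1) idx_le by blast
    show "p0 \<in> I" by (rule p0)
    show "a (idx p0) \<notin> {r \<in> carrier R. h r \<in> J}"
    proof
      assume "a (idx p0) \<in> {r \<in> carrier R. h r \<in> J}"
      then have "h (s N) \<otimes>\<^bsub>L\<^esub> f N \<in> J" using as(3)[of N] p0 by simp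
      then have "f N \<in> J"
        by (intro saturated_idealD(2)[OF J fL h.hom_closed[OF sR] hs]) simp_all
      then show False using fN by simp
    qed
    fix c assume c: "c \<in> I \<rightarrow> carrier R" and rel: "(\<Oplus>p\<in>I. c p \<otimes> a (idx p)) = \<zero>"
    \<comment> \<open>The factor \<open>h (s k)\<close> turns a relation among the numerators into
      one among the \<open>f k\<close>. It is removed at the end because \<open>P 3\<close> is prime
      and does not contain it.\<close>
    define c' where "c' k = h (c (the_inv_into I idx k)) \<otimes>\<^bsub>L\<^esub> h (s k)" for k
    have c'_idx: "c' (idx p) = h (c p) \<otimes>\<^bsub>L\<^esub> h (s (idx p))" if "p \<in> I" for p
      using that idx_inj by (simp add: c'_def the_inv_into_f_f)
    have cR: "c p \<in> carrier R" if "p \<in> I" for p using c that by auto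
    have c'L: "c' \<in> {..N} \<rightarrow> carrier L"
    proof
      fix k assume "k \<in> {..N}"
      then obtain p where "p \<in> I" "k = idx p" using idx_img by blast
      then show "c' k \<in> carrier L" using cR sR idx_le by (simp add: c'_idx)
    qed
    have "(\<Oplus>\<^bsub>L\<^esub>k\<in>{..N}. c' k \<otimes>\<^bsub>L\<^esub> f k) = (\<Oplus>\<^bsub>L\<^esub>p\<in>I. c' (idx p) \<otimes>\<^bsub>L\<^esub> f (idx p))"
      unfolding idx_img[symmetric] using c'L fL idx_inj idx_img
      by (intro L.finsum_reindex) (auto simp: Pi_iff)
    also have "\<dots> = (\<Oplus>\<^bsub>L\<^esub>p\<in>I. h (c p \<otimes> a (idx p)))"
    proof (rule L.finsum_cong')
      fix p assume p: "p \<in> I"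
      note k = idx_le[OF p]
      have "c' (idx p) \<otimes>\<^bsub>L\<^esub> f (idx p) = h (c p) \<otimes>\<^bsub>L\<^esub> (h (s (idx p)) \<otimes>\<^bsub>L\<^esub> f (idx p))"
        using cR[OF p] sR[OF k] fL[OF k] by (simp add: c'_idx[OF p] L.m_assoc)
      then show "c' (idx p) \<otimes>\<^bsub>L\<^esub> f (idx p) = h (c p \<otimes> a (idx p))"
        using as(1,3)[OF k] cR[OF p] by simp
    qed (use cR as(1) idx_le in auto)
    also have "\<dots> = h (\<Oplus>p\<in>I. c p \<otimes> a (idx p))"
      using h.hom_finsum[of "\<lambda>p. c p \<otimes> a (idx p)" I] cR as(1) idx_le by (simp add: o_def Pi_iff)
    also have "\<dots> = \<zero>\<^bsub>L\<^esub>" using rel by simp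
    finally have c'P: "c' \<in> {..N} \<rightarrow> P 3" by (rule indep[OF c'L])
    have "h (c p) \<in> P 3" if p: "p \<in> I" for p
    proof -
      have "c' (idx p) \<in> P 3" using c'P idx_le[OF p] by auto
      then have "h (c p) \<otimes>\<^bsub>L\<^esub> h (s (idx p)) \<in> P 3" by (simp add: c'_idx[OF p])
      then show ?thesis
        using M.I_prime h.hom_closed[OF cR[OF p]] h.hom_closed[OF sR[OF idx_le[OF p]]] hs[OF idx_le[OF p]]
        by blast
    qed
    then show "c \<in> I \<rightarrow> {r \<in> carrier R. h r \<in> P 3}" using cR by auto
  qed
qed

end

text \<open>Since \<open>d - 1\<close> is below the supremum, some chain is longer than
  \<open>d - 1\<close>, and its first \<open>d\<close> steps form the required one;
  \<open>0 < d\<close> makes the truncated difference smaller than \<open>m\<close>.\<close>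

lemma krull_dim_chain:
  fixes R :: "('a, 'b) ring_scheme"
  assumes "krull_dim R = enat m" "0 < d" "d \<le> m"
  shows "\<exists>P :: nat \<Rightarrow> 'a set. (\<forall>i\<le>d. primeideal (P i) R) \<and> (\<forall>i<d. P i \<subset> P (Suc i))"
proof -
  have "enat (d - 1) < krull_dim R" using assms by simp
  then obtain k P where "enat (d - 1) < enat k" "\<forall>i\<le>k. primeideal (P i) R" "\<forall>i<k. P i \<subset> P (Suc i)"
    unfolding krull_dim_def less_Sup_iff by blast
  then show ?thesis by (intro exI[of _ P]) auto
qed

theorem theorem3p8:
  fixes R :: "('a, 'b) ring_scheme" and \<mm> :: "'a set" and m n :: nat
  assumes "cring R"
    and "maximalideal \<mm> R"
    and "regular_local_ring (localization_at R \<mm>)"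
    and "krull_dim (localization_at R \<mm>) = enat m"
    and "m \<ge> 3"
    and "n \<ge> 2"
    and "real n \<le> (real m ^ 2 + 2 * real m + 5) / 8"
  shows "\<exists>C \<in> carrier (matrix_ring R n).
    matrix_trace R n C = \<zero>\<^bsub>R\<^esub> \<and> \<not> is_commutator (matrix_ring R n) C"
proof -
  interpret cring R by fact
  interpret \<mm>: primeideal \<mm> R using assms(2) by (rule maximalideal_prime)
  have "submonoid (carrier R - \<mm>) R"
    using \<mm>.I_notcarr \<mm>.I_prime \<mm>.one_imp_carrier by unfold_locales auto
  then interpret mult_subset R "carrier R - \<mm>"
    by (intro mult_subset.intro is_cring)
  have "noetherian_ring (localization R (carrier R - \<mm>))"
    using assms(3) by (simp add: localization_at_def regular_local_ring_def)
  \<comment> \<open>Four primes of the localisation; for \<open>m > 3\<close> the last one may be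
    smaller than its maximal ideal.\<close>
  moreover obtain P where "\<forall>i\<le>3. primeideal (P i) (localization R (carrier R - \<mm>))"
    "\<forall>i<3. P i \<subset> P (Suc i)"
    using krull_dim_chain[OF assms(4), of 3] assms(5) by (auto simp: localization_at_def)
  ultimately show ?thesis
    using ex_trace_zero_not_commutator_localization[of P n] assms(6) by blast
qed

end
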